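(* Let $p$ be an odd prime and let $G$ be a $p$-group of order $p^m$ of rank $5$ belonging to the isoclinism family $\Phi_7$. Then (1) $\displaystyle A_G(t/|G|)=\frac{1-p^{-2}}{1-p^{-2}t} + \frac{p^{-2}-p^{-4}}{1-p^{-1}t} + \frac{p^{-4}}{1-t}$; (2) $\displaystyle B_G(t/|G|)=\frac{-p^{-1}-p^{-2}}{1-p^{-3}t} + \frac{1+p^{-1}+p^{-2}}{1-p^{-2}t}$.
   Context: For a finite group $G$ and $n\ge 0$, $\alpha_{G,n}$ denotes the number of orbits of $G$ acting on $G^n$ by simultaneous conjugation $g\cdot(x_1,\dots,x_n)=(gx_1g^{-1},\dots,gx_ng^{-1})$, and $\beta_{G,n}$ denotes the number of orbits of the same action on the set $G^{(n)}$ of $n$-tuples of pairwise commuting elements of $G$; $\alpha_{G,0}=\beta_{G,0}=1$. Set $A_G(t)=\sum_{n\ge 0}\alpha_{G,n}t^n$ and $B_G(t)=\sum_{n\ge 0}\beta_{G,n}t^n$ (formal power series, which are rational functions of $t$). $A_G(t/|G|)$, $B_G(t/|G|)$ denote the result of substituting $t/|G|$ for $t$. Finite groups $G,H$ are isoclinic if there are isomorphisms $\theta:G/Z(G)\to H/Z(H)$ and $\phi:G'\to H'$ (derived subgroups) such that $\phi([g_1,g_2])=[h_1,h_2]$ whenever $\theta(g_iZ(G))=h_iZ(H)$ for $i=1,2$. Isoclinism is an equivalence relation, whose classes are called isoclinism families. For a $p$-group $G$, the rank of (the family of) $G$ is the smallest $r$ such that the isoclinism family of $G$ contains a group of order $p^r$.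 $\Phi_7$ (James's notation) is the isoclinism family, of rank 5, of the group of order $p^5$ $$\Phi_7(1^5)=\langle \alpha, \alpha_1,\alpha_2,\alpha_3, \beta\mid[\alpha_i,\alpha]=\alpha_{i+1},\ [\alpha_1, \beta]=\alpha_3,\ \alpha^p=\alpha_1^{(p)}=\alpha_{i+1}^p=\beta^p=1\ (i=1,2) \rangle ,$$ where $\alpha_1^{(p)}$ denotes $\alpha_1^p\alpha_2^{\binom p2}\alpha_3^{\binom p3}$. Here $[x,y]=x^{-1}y^{-1}xy$, and by convention all pairs of generators whose commutator is not listed commute. $G$ belongs to $\Phi_7$ if $G$ is a finite $p$-group isoclinic to this group. *)

theory Defs
  imports
    Complex_Main
    "HOL-Algebra.Algebra"
    "HOL-Computational_Algebra.Formal_Power_Series"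
begin

section \<open>Simultaneous conjugation and the generating functions\<close>

definition group_tuples :: "('a, 'b) monoid_scheme \<Rightarrow> nat \<Rightarrow> 'a list set" where
  "group_tuples G n = {xs. length xs = n \<and> set xs \<subseteq> carrier G}"

definition commuting_tuples :: "('a, 'b) monoid_scheme \<Rightarrow> nat \<Rightarrow> 'a list set" where
  "commuting_tuples G n =
     {xs \<in> group_tuples G n. \<forall>x \<in> set xs. \<forall>y \<in> set xs. x \<otimes>\<^bsub>G\<^esub> y = y \<otimes>\<^bsub>G\<^esub> x}"

text \<open>The restriction to \<open>E\<close> is what the library's notion of a group action
  (a homomorphism to \<^const>\<open>BijGroup\<close>) asks for; it does not affect the orbits.\<close>

definition sim_conj :: "('a, 'b) monoid_scheme \<Rightarrow> 'a list set \<Rightarrow> 'a \<Rightarrow> 'a list \<Rightarrow> 'a list" where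
  "sim_conj G E = (\<lambda>g. \<lambda>xs \<in> E. map (\<lambda>x. g \<otimes>\<^bsub>G\<^esub> x \<otimes>\<^bsub>G\<^esub> inv\<^bsub>G\<^esub> g) xs)"

lemma (in group) sim_conj_action:
  assumes stable: "\<And>g xs. g \<in> carrier G \<Longrightarrow> xs \<in> E \<Longrightarrow> map (\<lambda>x. g \<otimes> x \<otimes> inv g) xs \<in> E"
    and sub: "\<And>xs. xs \<in> E \<Longrightarrow> set xs \<subseteq> carrier G"
  shows "group_action G E (sim_conj G E)"
proof -
  have comp: "map (\<lambda>x. g \<otimes> x \<otimes> inv g) (map (\<lambda>x. h \<otimes> x \<otimes> inv h) xs)
      = map (\<lambda>x. (g \<otimes> h) \<otimes> x \<otimes> inv (g \<otimes> h)) xs"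
    if "g \<in> carrier G" "h \<in> carrier G" "xs \<in> E" for g h xs
  proof -
    have "g \<otimes> (h \<otimes> x \<otimes> inv h) \<otimes> inv g = (g \<otimes> h) \<otimes> x \<otimes> inv (g \<otimes> h)"
      if "x \<in> carrier G" for x
      using that \<open>g \<in> carrier G\<close> \<open>h \<in> carrier G\<close> by (simp add: m_assoc inv_mult_group)
    thus ?thesis using sub[OF that(3)] by auto
  qed
  have unit: "map (\<lambda>x. \<one> \<otimes> x \<otimes> inv \<one>) xs = xs" if "xs \<in> E" for xs
    using sub[OF that] by (auto intro!: map_idI)
  have app: "sim_conj G E g xs = map (\<lambda>x. g \<otimes> x \<otimes> inv g) xs" if "xs \<in> E" for g xs
    using that by (simp add: sim_conj_def)
  have in_E: "sim_conj G E g xs \<in> E" if "g \<in> carrier G" "xs \<in> E" for g xs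
    unfolding app[OF that(2)] using that by (rule stable)
  have mult: "sim_conj G E g (sim_conj G E h xs) = sim_conj G E (g \<otimes> h) xs"
    if "g \<in> carrier G" "h \<in> carrier G" "xs \<in> E" for g h xs
    using comp[OF that] app[OF in_E[OF that(2,3)]] app[OF that(3)] by simp
  have one: "sim_conj G E \<one> xs = xs" if "xs \<in> E" for xs
    unfolding app[OF that] using that by (rule unit)
  have bij: "sim_conj G E g \<in> Bij E" if g: "g \<in> carrier G" for g
  proof -
    have "bij_betw (sim_conj G E g) E E"
      by (rule bij_betw_byWitness[where f' = "sim_conj G E (inv g)"])
        (use g in \<open>auto simp: mult one in_E\<close>)
    thus ?thesis by (simp add: Bij_def sim_conj_def)
  qed
  have "sim_conj G E (g \<otimes> h) = compose E (sim_conj G E g) (sim_conj G E h)"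
    if "g \<in> carrier G" "h \<in> carrier G" for g h
  proof (rule extensionalityI)
    show "sim_conj G E (g \<otimes> h) \<in> extensional E" by (simp add: sim_conj_def)
    show "compose E (sim_conj G E g) (sim_conj G E h) \<in> extensional E"
      by (rule compose_extensional)
  qed (simp add: compose_eq mult[OF that])
  hence "sim_conj G E \<in> hom G (BijGroup E)"
    using bij by (auto simp: hom_def BijGroup_def)
  thus ?thesis
    by (simp add: group_action_def group_hom_def group_hom_axioms_def group_BijGroup is_group)
qed

lemma (in group) sim_conj_action_tuples:
  "group_action G (group_tuples G n) (sim_conj G (group_tuples G n))"
  by (rule sim_conj_action) (auto simp: group_tuples_def)

lemma (in group) sim_conj_action_commuting:
  "group_action G (commuting_tuples G n) (sim_conj G (commuting_tuples G n))"
proof (rule sim_conj_action)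
  fix g xs assume g: "g \<in> carrier G" and xs: "xs \<in> commuting_tuples G n"
  have conj: "(g \<otimes> x \<otimes> inv g) \<otimes> (g \<otimes> y \<otimes> inv g) = g \<otimes> (x \<otimes> y) \<otimes> inv g"
    if "x \<in> carrier G" "y \<in> carrier G" for x y
  proof -
    have "inv g \<otimes> (g \<otimes> (y \<otimes> inv g)) = y \<otimes> inv g"
      using g that by (metis inv_closed l_inv l_one m_assoc m_closed)
    thus ?thesis using g that by (simp add: m_assoc)
  qed
  show "map (\<lambda>x. g \<otimes> x \<otimes> inv g) xs \<in> commuting_tuples G n"
    using g xs by (auto simp: commuting_tuples_def group_tuples_def subset_iff conj)
qed (auto simp: commuting_tuples_def group_tuples_def)

definition tuple_orbits :: "('a, 'b) monoid_scheme \<Rightarrow> nat \<Rightarrow> nat" where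
  "tuple_orbits G n = card (orbits G (group_tuples G n) (sim_conj G (group_tuples G n)))"

definition commuting_orbits :: "('a, 'b) monoid_scheme \<Rightarrow> nat \<Rightarrow> nat" where
  "commuting_orbits G n =
     card (orbits G (commuting_tuples G n) (sim_conj G (commuting_tuples G n)))"

definition A_series :: "('a, 'b) monoid_scheme \<Rightarrow> real fps" where
  "A_series G = Abs_fps (\<lambda>n. real (tuple_orbits G n))"

definition B_series :: "('a, 'b) monoid_scheme \<Rightarrow> real fps" where
  "B_series G = Abs_fps (\<lambda>n. real (commuting_orbits G n))"


section \<open>Isoclinism\<close>

definition group_center :: "('a, 'b) monoid_scheme \<Rightarrow> 'a set" where
  "group_center G = {z \<in> carrier G. \<forall>g \<in> carrier G. z \<otimes>\<^bsub>G\<^esub> g = g \<otimes>\<^bsub>G\<^esub> z}"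

definition group_commutator :: "('a, 'b) monoid_scheme \<Rightarrow> 'a \<Rightarrow> 'a \<Rightarrow> 'a" where
  "group_commutator G x y = inv\<^bsub>G\<^esub> x \<otimes>\<^bsub>G\<^esub> inv\<^bsub>G\<^esub> y \<otimes>\<^bsub>G\<^esub> x \<otimes>\<^bsub>G\<^esub> y"

definition derived_group :: "('a, 'b) monoid_scheme \<Rightarrow> ('a, 'b) monoid_scheme" where
  "derived_group G = G\<lparr>carrier := derived G (carrier G)\<rparr>"

text \<open>The elements of \<open>G Mod Z\<close> are right cosets; for central \<open>Z\<close> these are also the left ones.\<close>

definition isoclinic :: "('a, 'b) monoid_scheme \<Rightarrow> ('c, 'd) monoid_scheme \<Rightarrow> bool" where
  "isoclinic G H \<longleftrightarrow>
     (\<exists>\<theta> \<in> iso (G Mod group_center G) (H Mod group_center H).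
      \<exists>\<phi> \<in> iso (derived_group G) (derived_group H).
        \<forall>g1 \<in> carrier G. \<forall>g2 \<in> carrier G. \<forall>h1 \<in> carrier H. \<forall>h2 \<in> carrier H.
          \<theta> (group_center G #>\<^bsub>G\<^esub> g1) = group_center H #>\<^bsub>H\<^esub> h1 \<longrightarrow>
          \<theta> (group_center G #>\<^bsub>G\<^esub> g2) = group_center H #>\<^bsub>H\<^esub> h2 \<longrightarrow>
          \<phi> (group_commutator G g1 g2) = group_commutator H h1 h2)"

definition finite_p_group :: "nat \<Rightarrow> ('a, 'b) monoid_scheme \<Rightarrow> bool" where
  "finite_p_group p G \<longleftrightarrow> group G \<and> finite (carrier G) \<and> (\<exists>k. order G = p ^ k)"

text \<open>Groups with carrier in \<^typ>\<open>nat\<close> represent all finite groups up to isomorphism.\<close>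

definition isoclinism_rank :: "nat \<Rightarrow> ('a, 'b) monoid_scheme \<Rightarrow> nat" where
  "isoclinism_rank p G =
     (LEAST r. \<exists>H :: nat monoid. group H \<and> finite (carrier H) \<and> order H = p ^ r \<and> isoclinic G H)"


section \<open>Groups given by generators and relations\<close>

text \<open>A letter \<open>(x, True)\<close> is the generator \<open>x\<close>, a letter \<open>(x, False)\<close> is its inverse.\<close>

type_synonym 'g word = "('g \<times> bool) list"

definition gen :: "'g \<Rightarrow> 'g word" where
  "gen x = [(x, True)]"

definition word_inv :: "'g word \<Rightarrow> 'g word" where
  "word_inv w = rev (map (\<lambda>(x, b). (x, \<not> b)) w)"

definition word_pow :: "'g word \<Rightarrow> nat \<Rightarrow> 'g word" where
  "word_pow w n = concat (replicate n w)"

definition word_commutator :: "'g word \<Rightarrow> 'g word \<Rightarrow> 'g word" where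
  "word_commutator u v = word_inv u @ word_inv v @ u @ v"

text \<open>Equality of words in the group generated by all elements of \<^typ>\<open>'g\<close> subject to
  \<open>u = v\<close> for \<open>(u, v) \<in> R\<close>.\<close>

inductive pres_eq :: "('g word \<times> 'g word) set \<Rightarrow> 'g word \<Rightarrow> 'g word \<Rightarrow> bool"
  for R :: "('g word \<times> 'g word) set" where
  refl: "pres_eq R u u"
| sym: "pres_eq R u v \<Longrightarrow> pres_eq R v u"
| trans: "pres_eq R u v \<Longrightarrow> pres_eq R v w \<Longrightarrow> pres_eq R u w"
| append: "pres_eq R u v \<Longrightarrow> pres_eq R u' v' \<Longrightarrow> pres_eq R (u @ u') (v @ v')"
| cancel: "pres_eq R [(x, b), (x, \<not> b)] []"
| rel: "(u, v) \<in> R \<Longrightarrow> pres_eq R u v"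

definition pres_class :: "('g word \<times> 'g word) set \<Rightarrow> 'g word \<Rightarrow> 'g word set" where
  "pres_class R w = {v. pres_eq R w v}"

definition presented_group :: "('g word \<times> 'g word) set \<Rightarrow> 'g word set monoid" where
  "presented_group R =
     \<lparr>carrier = range (pres_class R),
      monoid.mult = (\<lambda>A B. \<Union>u \<in> A. \<Union>v \<in> B. pres_class R (u @ v)),
      one = pres_class R []\<rparr>"

lemma pres_class_eq_iff: "pres_class R u = pres_class R v \<longleftrightarrow> pres_eq R u v"
  unfolding pres_class_def set_eq_iff mem_Collect_eq
  by (meson pres_eq.refl pres_eq.sym pres_eq.trans)

lemma presented_group_mult:
  "pres_class R u \<otimes>\<^bsub>presented_group R\<^esub> pres_class R v = pres_class R (u @ v)"
proof -
  have "pres_class R (u' @ v') = pres_class R (u @ v)"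
    if "u' \<in> pres_class R u" "v' \<in> pres_class R v" for u' v'
  proof -
    have "pres_eq R (u @ v) (u' @ v')"
      using that by (simp add: pres_class_def pres_eq.append)
    thus ?thesis unfolding pres_class_eq_iff by (rule pres_eq.sym)
  qed
  moreover have "u \<in> pres_class R u" "v \<in> pres_class R v"
    by (auto simp: pres_class_def pres_eq.refl)
  ultimately have "(\<Union>u' \<in> pres_class R u. \<Union>v' \<in> pres_class R v. pres_class R (u' @ v')) =
      pres_class R (u @ v)"
    by blast
  thus ?thesis by (simp add: presented_group_def)
qed

lemma pres_eq_word_inv: "pres_eq R (word_inv w @ w) []"
proof (induction w)
  case Nil
  show ?case by (simp add: word_inv_def pres_eq.refl)
next
  case (Cons a w)
  obtain x b where a: "a = (x, b)" by (cases a)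
  have "pres_eq R ([(x, \<not> b), (x, b)] @ w) ([] @ w)"
    using pres_eq.append[OF pres_eq.cancel[of R x "\<not> b"] pres_eq.refl[of R w]] by simp
  hence "pres_eq R (word_inv w @ [(x, \<not> b), (x, b)] @ w) (word_inv w @ [] @ w)"
    by (rule pres_eq.append[OF pres_eq.refl])
  hence "pres_eq R (word_inv (a # w) @ a # w) (word_inv w @ w)"
    by (simp add: word_inv_def a)
  thus ?case using Cons.IH by (rule pres_eq.trans)
qed

lemma group_presented_group: "group (presented_group R)"
proof (rule groupI)
  let ?P = "presented_group R"
  have car: "carrier ?P = range (pres_class R)" and one: "\<one>\<^bsub>?P\<^esub> = pres_class R []"
    by (simp_all add: presented_group_def)
  show "\<one>\<^bsub>?P\<^esub> \<in> carrier ?P" by (simp add: car one)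
  fix x assume "x \<in> carrier ?P"
  then obtain u where u: "x = pres_class R u" by (auto simp: car)
  show "\<one>\<^bsub>?P\<^esub> \<otimes>\<^bsub>?P\<^esub> x = x" by (simp add: u one presented_group_mult)
  have "pres_class R (word_inv u) \<otimes>\<^bsub>?P\<^esub> x = \<one>\<^bsub>?P\<^esub>"
    by (simp add: u one presented_group_mult pres_class_eq_iff pres_eq_word_inv)
  thus "\<exists>y\<in>carrier ?P. y \<otimes>\<^bsub>?P\<^esub> x = \<one>\<^bsub>?P\<^esub>" unfolding car by blast
next
  have car: "carrier (presented_group R) = range (pres_class R)"
    by (simp add: presented_group_def)
  fix x y z
  assume "x \<in> carrier (presented_group R)" and "y \<in> carrier (presented_group R)"
  then obtain u v where uv: "x = pres_class R u" "y = pres_class R v"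
    unfolding car by blast
  show "x \<otimes>\<^bsub>presented_group R\<^esub> y \<in> carrier (presented_group R)"
    unfolding uv presented_group_mult car by blast
  assume "z \<in> carrier (presented_group R)"
  then obtain w where w: "z = pres_class R w"
    unfolding car by blast
  show "x \<otimes>\<^bsub>presented_group R\<^esub> y \<otimes>\<^bsub>presented_group R\<^esub> z =
      x \<otimes>\<^bsub>presented_group R\<^esub> (y \<otimes>\<^bsub>presented_group R\<^esub> z)"
    unfolding uv w presented_group_mult by simp
qed


section \<open>The family \<open>\<Phi>\<^sub>7\<close>\<close>

datatype phi7_gen = Al | Al1 | Al2 | Al3 | Be

definition phi7_commutators :: "(phi7_gen \<times> phi7_gen \<times> phi7_gen) set" where
  "phi7_commutators = {(Al1, Al, Al2), (Al2, Al, Al3), (Al1, Be, Al3)}"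

text \<open>The second set says that generators commute if neither commutator of the two is listed.\<close>

definition phi7_relations :: "nat \<Rightarrow> (phi7_gen word \<times> phi7_gen word) set" where
  "phi7_relations p =
     {(word_commutator (gen x) (gen y), gen z) | x y z. (x, y, z) \<in> phi7_commutators} \<union>
     {(word_commutator (gen x) (gen y), []) | x y.
        \<forall>z. (x, y, z) \<notin> phi7_commutators \<and> (y, x, z) \<notin> phi7_commutators} \<union>
     {(word_pow (gen Al) p, []),
      (word_pow (gen Al1) p @ word_pow (gen Al2) (p choose 2) @ word_pow (gen Al3) (p choose 3), []),
      (word_pow (gen Al2) p, []),
      (word_pow (gen Al3) p, []),
      (word_pow (gen Be) p, [])}"

definition phi7_group :: "nat \<Rightarrow> phi7_gen word set monoid" where
  "phi7_group p = presented_group (phi7_relations p)"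

definition in_phi7 :: "nat \<Rightarrow> ('a, 'b) monoid_scheme \<Rightarrow> bool" where
  "in_phi7 p G \<longleftrightarrow> finite_p_group p G \<and> isoclinic G (phi7_group p)"

end

theory Submission
  imports Defs
begin

text \<open>By Burnside's lemma the number of orbits on \<open>G\<^sup>n\<close> is the mean of the \<open>n\<close>-th powers of the
  centralizer orders, and the number of orbits on commuting \<open>n\<close>-tuples is \<open>1/|G|\<close> times the number
  of commuting \<open>(n + 1)\<close>-tuples. Both depend only on \<open>|Z(G)|\<close> and on the commutation relation
  on \<open>G/Z(G)\<close>, which isoclinism transfers from \<open>\<Phi>\<^sub>7(1\<^sup>5)\<close>. There, \<open>G/Z(G)\<close> is identified with
  \<open>(\<int>/p)\<^sup>4\<close> in such a way that \<open>(a, b, c, d)\<close> and \<open>(a', b', c', d')\<close> commute iff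
  \<open>a b' = a' b\<close> and \<open>a c' + d b' = a' c + d' b\<close>. The centralizer of \<open>(a, b, c, d)\<close> has \<open>p\<^sup>2\<close>
  elements and is abelian if \<open>(a, b) \<noteq> 0\<close>, and has \<open>p\<^sup>3\<close> elements if \<open>(a, b) = 0 \<noteq> (c, d)\<close>;
  counting commuting tuples by their first entry gives a linear recursion. That the presentation
  does not collapse is seen from an explicit multiplication of exponent vectors, in which
  \<open>\<alpha>\<close> acts on \<open>\<langle>\<alpha>\<^sub>1, \<alpha>\<^sub>2, \<alpha>\<^sub>3\<rangle>\<close> as a unipotent Jordan block \<open>1 + x\<close> and \<open>\<beta>\<close> as \<open>1 + x\<^sup>2\<close>.\<close>

subsection \<open>Tuples of pairwise related elements\<close>

text \<open>An arbitrary relation is allowed because the same count is made for commutation in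
  \<open>G\<close> and for \<open>phi7_comm\<close> on coordinates.\<close>

definition pairwise_tuples :: "('a \<Rightarrow> 'a \<Rightarrow> bool) \<Rightarrow> 'a set \<Rightarrow> nat \<Rightarrow> 'a list set" where
  "pairwise_tuples R S n =
     {xs. length xs = n \<and> set xs \<subseteq> S \<and> (\<forall>x \<in> set xs. \<forall>y \<in> set xs. R x y)}"

lemma finite_pairwise_tuples: "finite S \<Longrightarrow> finite (pairwise_tuples R S n)"
  by (rule finite_subset[OF _ finite_lists_length_eq[of S n]]) (auto simp: pairwise_tuples_def)

lemma card_pairwise_tuples_0 [simp]: "card (pairwise_tuples R S 0) = 1"
proof -
  have "pairwise_tuples R S 0 = {[]}" by (auto simp: pairwise_tuples_def)
  thus ?thesis by simp
qed

lemma card_pairwise_tuples_clique: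
  assumes "finite S" "\<And>x y. x \<in> S \<Longrightarrow> y \<in> S \<Longrightarrow> R x y"
  shows "card (pairwise_tuples R S n) = card S ^ n"
proof -
  have "pairwise_tuples R S n = {xs. set xs \<subseteq> S \<and> length xs = n}"
    using assms(2) by (auto simp: pairwise_tuples_def subset_iff)
  thus ?thesis by (simp add: card_lists_length_eq assms(1))
qed

text \<open>Splitting off the first entry \<open>x\<close> leaves a tuple in the set of elements
  related to \<open>x\<close>; reflexivity and symmetry restore the pairs that involve
  \<open>x\<close>.\<close>

lemma card_pairwise_tuples_Suc:
  assumes fin: "finite S" and refl: "\<And>x. x \<in> S \<Longrightarrow> R x x"
    and sym: "\<And>x y. x \<in> S \<Longrightarrow> y \<in> S \<Longrightarrow> R x y \<Longrightarrow> R y x"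
  shows "card (pairwise_tuples R S (Suc n)) =
    (\<Sum>x\<in>S. card (pairwise_tuples R {y \<in> S. R x y} n))"
proof -
  have "pairwise_tuples R S (Suc n) =
      (\<lambda>(x, xs). x # xs) ` (SIGMA x:S. pairwise_tuples R {y \<in> S. R x y} n)" (is "?L = ?f ` ?A")
  proof
    show "?L \<subseteq> ?f ` ?A"
    proof
      fix ys assume "ys \<in> ?L"
      moreover from this obtain x xs where "ys = x # xs"
        by (cases ys) (auto simp: pairwise_tuples_def)
      ultimately have "(x, xs) \<in> ?A" "ys = ?f (x, xs)"
        by (auto simp: pairwise_tuples_def)
      thus "ys \<in> ?f ` ?A" by blast
    qed
    show "?f ` ?A \<subseteq> ?L"
      using refl sym by (fastforce simp: pairwise_tuples_def)
  qed
  moreover have "inj_on ?f ?A" by (auto simp: inj_on_def)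
  ultimately have "card (pairwise_tuples R S (Suc n)) = card ?A"
    by (simp add: card_image)
  thus ?thesis using fin by (simp add: finite_pairwise_tuples)
qed

lemma sum_over_fibres:
  fixes F :: "'a \<Rightarrow> 'b" and g :: "'b \<Rightarrow> nat"
  assumes "finite S" "finite V" "F ` S \<subseteq> V"
    and fibre: "\<And>v. v \<in> V \<Longrightarrow> card {x \<in> S. F x = v} = z"
  shows "(\<Sum>x\<in>S. g (F x)) = z * (\<Sum>v\<in>V. g v)"
proof -
  have "(\<Sum>x\<in>S. g (F x)) = (\<Sum>v\<in>V. \<Sum>x\<in>{x \<in> S. F x = v}. g (F x))"
    by (rule sum.group[symmetric]) (use assms in auto)
  also have "\<dots> = (\<Sum>v\<in>V. z * g v)"
    by (rule sum.cong) (auto simp: fibre)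
  finally show ?thesis by (simp add: sum_distrib_left)
qed

text \<open>Splitting off \<open>x\<close> restricts \<open>S\<close> to the elements related to
  \<open>x\<close> and \<open>V\<close> to those related to \<open>F x\<close>. As \<open>R\<close>
  depends only on \<open>F\<close>, the fibres over the smaller base are unchanged, so induction
  with \<open>S\<close> and \<open>V\<close> varying applies.\<close>

lemma card_pairwise_tuples_fibres:
  assumes "finite S" "finite V" "F ` S \<subseteq> V"
    and "\<And>v. v \<in> V \<Longrightarrow> card {x \<in> S. F x = v} = z"
    and R: "\<And>x y. x \<in> S \<Longrightarrow> y \<in> S \<Longrightarrow> R x y \<longleftrightarrow> R' (F x) (F y)"
    and refl: "\<And>v. v \<in> V \<Longrightarrow> R' v v"
    and sym: "\<And>v w. v \<in> V \<Longrightarrow> w \<in> V \<Longrightarrow> R' v w \<Longrightarrow> R' w v"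
  shows "card (pairwise_tuples R S n) = z ^ n * card (pairwise_tuples R' V n)"
  using assms
proof (induction n arbitrary: S V)
  case 0
  show ?case by simp
next
  case (Suc n S V)
  note prems = Suc.prems
  have IH: "card (pairwise_tuples R {y \<in> S. R x y} n) =
      z ^ n * card (pairwise_tuples R' {w \<in> V. R' (F x) w} n)" if x: "x \<in> S" for x
  proof (rule Suc.IH)
    show "F ` {y \<in> S. R x y} \<subseteq> {w \<in> V. R' (F x) w}" using prems(3,5) x by auto
    show "card {y \<in> {y \<in> S. R x y}. F y = v} = z" if "v \<in> {w \<in> V. R' (F x) w}" for v
    proof -
      have "{y \<in> {y \<in> S. R x y}. F y = v} = {y \<in> S. F y = v}" using prems(5)[OF x] that by auto
      thus ?thesis using prems(4) that by simp
    qed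
  qed (use prems in auto)
  have FV: "F x \<in> V" if "x \<in> S" for x using prems(3) that by blast
  have "card (pairwise_tuples R S (Suc n)) =
      (\<Sum>x\<in>S. card (pairwise_tuples R {y \<in> S. R x y} n))"
    by (rule card_pairwise_tuples_Suc) (use prems FV in auto)
  also have "\<dots> = z ^ n * (\<Sum>x\<in>S. card (pairwise_tuples R' {w \<in> V. R' (F x) w} n))"
    by (simp add: IH sum_distrib_left)
  also have "\<dots> = z ^ n * (z * (\<Sum>v\<in>V. card (pairwise_tuples R' {w \<in> V. R' v w} n)))"
    by (subst sum_over_fibres[OF prems(1-4), symmetric]) auto
  also have "(\<Sum>v\<in>V. card (pairwise_tuples R' {w \<in> V. R' v w} n)) =
      card (pairwise_tuples R' V (Suc n))"
    by (rule card_pairwise_tuples_Suc[symmetric]) (use prems in auto)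
  finally show ?case by (simp add: mult_ac)
qed

subsection \<open>The commutation relation on \<open>(\<int>/p)\<^sup>4\<close>\<close>

text \<open>The two forms are the coefficients of
  \<open>(a + d x)(b' + c' x) - (a' + d' x)(b + c x)\<close> modulo \<open>x\<^sup>2\<close>: two
  rows over the dual numbers over \<open>\<int>/p\<close> commute iff their determinant
  vanishes.\<close>

fun phi7_comm :: "int \<Rightarrow> int \<times> int \<times> int \<times> int \<Rightarrow> int \<times> int \<times> int \<times> int \<Rightarrow> bool" where
  "phi7_comm p (a, b, c, d) (a', b', c', d') \<longleftrightarrow>
     p dvd a * b' - a' * b \<and> p dvd a * c' - a' * c + d * b' - d' * b"

definition phi7_space :: "int \<Rightarrow> (int \<times> int \<times> int \<times> int) set" where
  "phi7_space p = {0..<p} \<times> {0..<p} \<times> {0..<p} \<times> {0..<p}"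

lemma finite_phi7_space [simp]: "finite (phi7_space p)"
  by (simp add: phi7_space_def)

lemma phi7_comm_refl: "phi7_comm p v v"
  by (cases v) (simp add: algebra_simps)

lemma phi7_comm_sym: "phi7_comm p v w \<Longrightarrow> phi7_comm p w v"
proof (cases v; cases w)
  fix a b c d a' b' c' d'
  assume vw: "v = (a, b, c, d)" "w = (a', b', c', d')" and "phi7_comm p v w"
  hence "p dvd - (a * b' - a' * b)" "p dvd - (a * c' - a' * c + d * b' - d' * b)"
    by (simp_all only: phi7_comm.simps dvd_minus_iff)
  thus ?thesis by (simp add: vw algebra_simps)
qed

section \<open>Linear congruences modulo a prime\<close>

lemma residue_zero_iff: "x \<in> {0..<p} \<Longrightarrow> p dvd x \<longleftrightarrow> x = 0" for x p :: int
  by (auto dest: zdvd_imp_le)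

context
  fixes p :: int
  assumes prime_p: "Factorial_Ring.prime p"
begin

text \<open>Bezout gives an inverse \<open>e\<close> of \<open>d\<close> modulo \<open>p\<close>, so
  each \<open>x\<close> admits exactly one residue \<open>y\<close> and the solutions form a graph
  over \<open>{0..<p}\<close>.\<close>

lemma card_linear_solutions_aux:
  assumes d: "\<not> p dvd d"
  shows "card {(x, y) \<in> {0..<p} \<times> {0..<p}. p dvd c * x + d * y + r} = nat p"
proof -
  have p0: "p > 0" using prime_p prime_gt_0_int by blast
  have "coprime p d" using prime_p d by (simp add: prime_imp_coprime)
  then obtain e k where ek: "e * d + k * p = 1"
    using bezout_int[of d "p"] by (metis coprime_commute coprime_iff_gcd_eq_1)
  have sol: "p dvd c * x + d * y + r \<longleftrightarrow> y = (- (c * x + r) * e) mod p"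
    if y: "y \<in> {0..<p}" for x y
  proof
    assume "p dvd c * x + d * y + r"
    then obtain j where j: "c * x + d * y + r = p * j" by (auto simp: dvd_def)
    have "y - - (c * x + r) * e = p * (j * e + k * y)" using j ek by Groebner_Basis.algebra
    hence "y mod p = (- (c * x + r) * e) mod p"
      by (metis mod_eq_dvd_iff dvd_triv_left)
    thus "y = (- (c * x + r) * e) mod p" using y by simp
  next
    assume "y = (- (c * x + r) * e) mod p"
    hence "y mod p = (- (c * x + r) * e) mod p" by simp
    then obtain j where j: "y - - (c * x + r) * e = p * j"
      by (metis mod_eq_dvd_iff dvd_def)
    have "c * x + d * y + r = p * (d * j + k * (c * x + r))" using j ek by Groebner_Basis.algebra
    thus "p dvd c * x + d * y + r" by simp
  qed
  have "{(x, y) \<in> {0..<p} \<times> {0..<p}. p dvd c * x + d * y + r} =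
      (\<lambda>x. (x, (- (c * x + r) * e) mod p)) ` {0..<p}"
    using sol p0 by auto
  moreover have "inj_on (\<lambda>x. (x, (- (c * x + r) * e) mod p)) {0..<p}"
    by (auto simp: inj_on_def)
  ultimately show ?thesis by (simp add: card_image)
qed

lemma card_linear_solutions:
  assumes "\<not> (p dvd c \<and> p dvd d)"
  shows "card {(x, y) \<in> {0..<p} \<times> {0..<p}. p dvd c * x + d * y + r} = nat p"
proof (cases "p dvd d")
  case True
  have "{(x, y) \<in> {0..<p} \<times> {0..<p}. p dvd c * x + d * y + r} =
      prod.swap ` {(x, y) \<in> {0..<p} \<times> {0..<p}. p dvd d * x + c * y + r}"
    by (auto simp: image_iff add_ac)
  moreover have "card \<dots> = card {(x, y) \<in> {0..<p} \<times> {0..<p}. p dvd d * x + c * y + r}"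
    by (rule card_image) (auto simp: inj_on_def)
  ultimately show ?thesis using card_linear_solutions_aux[of c d r] True assms by simp
qed (rule card_linear_solutions_aux)

text \<open>A row with \<open>(a, b)\<close> nonzero modulo \<open>p\<close> is unimodular over the
  dual numbers, so the rows having zero determinant with it are its multiples. The proof multiplies
  both forms by \<open>a\<close> and by \<open>b\<close> and cancels the factor that
  \<open>p\<close> does not divide.\<close>

lemma phi7_comm_centralizer_generic:
  assumes ab: "\<not> (p dvd a \<and> p dvd b)"
    and "phi7_comm p (a, b, c, d) v" "phi7_comm p (a, b, c, d) w"
  shows "phi7_comm p v w"
proof -
  obtain a1 b1 c1 d1 where v: "v = (a1, b1, c1, d1)" by (cases v)
  obtain a2 b2 c2 d2 where w: "w = (a2, b2, c2, d2)" by (cases w)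
  obtain k1 k2 l1 l2 where
    k: "a * b1 - a1 * b = p * k1" "a * b2 - a2 * b = p * k2"
    and l: "a * c1 - a1 * c + d * b1 - d1 * b = p * l1"
       "a * c2 - a2 * c + d * b2 - d2 * b = p * l2"
    using assms(2,3) unfolding v w phi7_comm.simps dvd_def by blast
  let ?D = "a1 * b2 - a2 * b1" and ?E = "a1 * c2 - a2 * c1 + d1 * b2 - d2 * b1"
  have aD: "a * ?D = p * (a1 * k2 - a2 * k1)" using k by Groebner_Basis.algebra
  have bD: "b * ?D = p * (b1 * k2 - b2 * k1)" using k by Groebner_Basis.algebra
  have cancel: "p dvd x" if "p dvd a * x" "p dvd b * x" for x
    using that ab prime_p by (auto simp: prime_dvd_mult_iff)
  have D: "p dvd ?D" by (rule cancel) (simp_all only: aD bD dvd_triv_left)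
  then obtain m where m: "?D = p * m" unfolding dvd_def by blast
  \<comment> \<open>The terms \<open>d * m\<close> here and \<open>c * m\<close> below enter through
    \<open>?D = p * m\<close>, so divisibility of the first form has to come first.\<close>
  have aE: "a * ?E = p * (a1 * l2 - a2 * l1 + d1 * k2 - d2 * k1 - d * m)"
    using k l m by Groebner_Basis.algebra
  have bE: "b * ?E = p * (b1 * l2 - b2 * l1 + c1 * k2 - c2 * k1 - c * m)"
    using k l m by Groebner_Basis.algebra
  have "p dvd ?E" by (rule cancel) (simp_all only: aE bE dvd_triv_left)
  thus ?thesis using D by (simp add: v w)
qed


section \<open>Centralizer orders in coordinates\<close>

lemma p_pos: "p > 0"
  using prime_p prime_gt_0_int by blast

lemma card_phi7_space: "card (phi7_space p) = nat p ^ 4"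
  by (simp add: phi7_space_def card_cartesian_product power4_eq_xxxx)

text \<open>Commuting with a fixed point is solved in two stages: the first form involves only the
  first two coordinates, and once these are chosen the second is an affine condition on the other
  two.\<close>

lemma card_phi7_space_split:
  "card {(x, y, z, t) \<in> phi7_space p. P x y \<and> Q x y z t} =
    (\<Sum>(x, y)\<in>{(x, y) \<in> {0..<p} \<times> {0..<p}. P x y}. card {(z, t) \<in> {0..<p} \<times> {0..<p}. Q x y z t})"
proof -
  let ?A = "{(x, y) \<in> {0..<p} \<times> {0..<p}. P x y}"
  let ?B = "\<lambda>u. {(z, t) \<in> {0..<p} \<times> {0..<p}. Q (fst u) (snd u) z t}"
  have "{(x, y, z, t) \<in> phi7_space p. P x y \<and> Q x y z t} =
      (\<lambda>((x, y), z, t). (x, y, z, t)) ` (SIGMA u:?A. ?B u)"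
    by (auto simp: phi7_space_def image_iff split_beta)
  moreover have "inj_on (\<lambda>((x, y), z, t). (x, y, z, t)) (SIGMA u:?A. ?B u)"
    by (auto simp: inj_on_def)
  moreover have "finite ?A" "finite (?B u)" for u
    by (rule finite_subset[of _ "{0..<p} \<times> {0..<p}"]; auto)+
  ultimately have "card {(x, y, z, t) \<in> phi7_space p. P x y \<and> Q x y z t} = (\<Sum>u\<in>?A. card (?B u))"
    by (simp only: card_image card_SigmaI simp_thms ball_simps)
  thus ?thesis by (simp only: case_prod_unfold)
qed

text \<open>Both stages are nondegenerate linear congruences: \<open>p\<close> choices of
  \<open>(x, y)\<close>, then \<open>p\<close> choices of \<open>(z, t)\<close>.\<close>

lemma card_centralizer_generic:
  assumes "\<not> (p dvd a \<and> p dvd b)"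
  shows "card {w \<in> phi7_space p. phi7_comm p (a, b, c, d) w} = nat p ^ 2"
proof -
  have set_eq: "{w \<in> phi7_space p. phi7_comm p (a, b, c, d) w} =
      {(x, y, z, t) \<in> phi7_space p. p dvd (- b) * x + a * y + 0 \<and> p dvd a * z + (- b) * t + (d * y - x * c)}"
    by (auto simp: algebra_simps)
  have ba: "\<not> (p dvd - b \<and> p dvd a)" and ab: "\<not> (p dvd a \<and> p dvd - b)" using assms by auto
  have "card {w \<in> phi7_space p. phi7_comm p (a, b, c, d) w} =
      (\<Sum>u\<in>{(x, y) \<in> {0..<p} \<times> {0..<p}. p dvd (- b) * x + a * y + 0}. nat p)"
    unfolding set_eq card_phi7_space_split
  proof (rule sum.cong[OF HOL.refl])
    fix u :: "int \<times> int"
    obtain x y where u: "u = (x, y)" by (cases u)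
    show "(case u of (x, y) \<Rightarrow> card {(z, t) \<in> {0..<p} \<times> {0..<p}.
        p dvd a * z + - b * t + (d * y - x * c)}) = nat p"
      unfolding u case_prod_conv by (rule card_linear_solutions[OF ab])
  qed
  thus ?thesis
    by (simp only: sum_constant card_linear_solutions[OF ba] power2_eq_square of_nat_id)
qed

text \<open>The first form vanishes identically and the second does not involve the last two
  coordinates, which leaves one congruence for \<open>(x, y)\<close> and \<open>p\<^sup>2\<close>
  free choices of \<open>(z, t)\<close>.\<close>

lemma card_centralizer_special:
  assumes "\<not> (p dvd c \<and> p dvd d)"
  shows "card {w \<in> phi7_space p. phi7_comm p (0, 0, c, d) w} = nat p ^ 3"
proof -
  have set_eq: "{w \<in> phi7_space p. phi7_comm p (0, 0, c, d) w} =
      {(x, y, z, t) \<in> phi7_space p. p dvd (- c) * x + d * y + 0 \<and> True}"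
    by (auto simp: algebra_simps)
  have cd: "\<not> (p dvd - c \<and> p dvd d)" using assms by auto
  have "{(z, t) \<in> {0..<p} \<times> {0..<p}. True} = {0..<p} \<times> {0..<p}" by auto
  hence "card {w \<in> phi7_space p. phi7_comm p (0, 0, c, d) w} =
      (\<Sum>u\<in>{(x, y) \<in> {0..<p} \<times> {0..<p}. p dvd (- c) * x + d * y + 0}. nat p * nat p)"
    unfolding set_eq card_phi7_space_split by (simp only: split_beta card_cartesian_product) simp
  thus ?thesis
    by (simp only: sum_constant card_linear_solutions[OF cd] power3_eq_cube of_nat_id mult.assoc)
qed

text \<open>Separates the three commutation types: the origin, the \<open>p\<^sup>2 - 1\<close>
  other points whose first two coordinates vanish, and the \<open>p\<^sup>4 - p\<^sup>2\<close>
  remaining points.\<close>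

lemma sum_phi7_space:
  fixes h :: "int \<times> int \<times> int \<times> int \<Rightarrow> real"
  assumes "h (0, 0, 0, 0) = h4"
    and "\<And>c d. (0, 0, c, d) \<in> phi7_space p \<Longrightarrow> (c, d) \<noteq> (0, 0) \<Longrightarrow> h (0, 0, c, d) = h3"
    and "\<And>a b c d. (a, b, c, d) \<in> phi7_space p \<Longrightarrow> (a, b) \<noteq> (0, 0) \<Longrightarrow> h (a, b, c, d) = h2"
  shows "(\<Sum>v\<in>phi7_space p. h v) =
    h4 + (real_of_int p ^ 2 - 1) * h3 + (real_of_int p ^ 4 - real_of_int p ^ 2) * h2"
proof -
  let ?V = "phi7_space p" and ?W = "{0::int} \<times> {0::int} \<times> {0..<p} \<times> {0..<p}"
  have W: "?W \<subseteq> ?V" "finite ?W" "card ?W = nat p ^ 2" and O: "{(0, 0, 0, 0)} \<subseteq> ?W"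
    using p_pos by (auto simp: phi7_space_def card_cartesian_product power2_eq_square)
  have q: "real (nat p) = real_of_int p" "1 \<le> nat p" using p_pos by auto
  have "real (card (?V - ?W)) = real (nat p ^ 4 - nat p ^ 2)"
    by (simp only: card_Diff_subset[OF W(2,1)] W(3) card_phi7_space)
  also have "\<dots> = real_of_int p ^ 4 - real_of_int p ^ 2"
    using q(2) by (subst of_nat_diff) (simp_all add: q(1) power_increasing)
  finally have cW: "real (card (?V - ?W)) = real_of_int p ^ 4 - real_of_int p ^ 2" .
  have "real (card (?W - {(0, 0, 0, 0)})) = real (nat p ^ 2 - 1)"
    using W(3) O by (simp only: card_Diff_subset[OF finite.insertI[OF finite.emptyI] O]) simp
  also have "\<dots> = real_of_int p ^ 2 - 1"
    using q by (simp add: of_nat_diff)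
  finally have cO: "real (card (?W - {(0, 0, 0, 0)})) = real_of_int p ^ 2 - 1" .
  have "sum h ?V = sum h (?V - ?W) + sum h ?W"
    by (rule sum.subset_diff[OF W(1)]) simp
  also have "sum h ?W = sum h (?W - {(0, 0, 0, 0)}) + sum h {(0, 0, 0, 0)}"
    by (rule sum.subset_diff[OF O W(2)])
  also have "sum h {(0, 0, 0, 0)} = h4" using assms(1) by simp
  also have "sum h (?W - {(0, 0, 0, 0)}) = (\<Sum>v\<in>?W - {(0, 0, 0, 0)}. h3)"
    by (rule sum.cong[OF HOL.refl]) (auto simp: phi7_space_def p_pos intro!: assms(2))
  also have "\<dots> = (real_of_int p ^ 2 - 1) * h3"
    by (simp only: sum_constant cO)
  also have "sum h (?V - ?W) = (\<Sum>v\<in>?V - ?W. h2)"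
    by (rule sum.cong[OF HOL.refl]) (auto simp: phi7_space_def intro!: assms(3))
  also have "\<dots> = (real_of_int p ^ 4 - real_of_int p ^ 2) * h2"
    by (simp only: sum_constant cW)
  finally show ?thesis by simp
qed

text \<open>This power sum of centralizer orders is what Burnside's lemma asks for on all
  \<open>n\<close>-tuples.\<close>

lemma phi7_centralizer_power_sum:
  "(\<Sum>v\<in>phi7_space p. real (card {w \<in> phi7_space p. phi7_comm p v w}) ^ n) =
    (real_of_int p ^ 4) ^ n + (real_of_int p ^ 2 - 1) * (real_of_int p ^ 3) ^ n
      + (real_of_int p ^ 4 - real_of_int p ^ 2) * (real_of_int p ^ 2) ^ n"
proof (rule sum_phi7_space)
  have "{w \<in> phi7_space p. phi7_comm p (0, 0, 0, 0) w} = phi7_space p" by auto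
  thus "real (card {w \<in> phi7_space p. phi7_comm p (0, 0, 0, 0) w}) ^ n = (real_of_int p ^ 4) ^ n"
    using p_pos by (simp add: card_phi7_space)
next
  fix c d assume "(0, 0, c, d) \<in> phi7_space p" "(c, d) \<noteq> (0, 0)"
  hence "\<not> (p dvd c \<and> p dvd d)" by (auto simp: phi7_space_def residue_zero_iff simp del: atLeastLessThan_iff)
  thus "real (card {w \<in> phi7_space p. phi7_comm p (0, 0, c, d) w}) ^ n = (real_of_int p ^ 3) ^ n"
    using p_pos by (simp add: card_centralizer_special)
next
  fix a b c d assume "(a, b, c, d) \<in> phi7_space p" "(a, b) \<noteq> (0, 0)"
  hence "\<not> (p dvd a \<and> p dvd b)" by (auto simp: phi7_space_def residue_zero_iff simp del: atLeastLessThan_iff)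
  thus "real (card {w \<in> phi7_space p. phi7_comm p (a, b, c, d) w}) ^ n = (real_of_int p ^ 2) ^ n"
    using p_pos by (simp add: card_centralizer_generic)
qed

section \<open>Commuting tuples in coordinates\<close>

lemma card_tuples_generic:
  assumes "\<not> (p dvd a \<and> p dvd b)"
  shows "card (pairwise_tuples (phi7_comm p) {w \<in> phi7_space p. phi7_comm p (a, b, c, d) w} n) =
    (nat p ^ 2) ^ n"
proof -
  have "card (pairwise_tuples (phi7_comm p) {w \<in> phi7_space p. phi7_comm p (a, b, c, d) w} n) =
      card {w \<in> phi7_space p. phi7_comm p (a, b, c, d) w} ^ n"
  proof (rule card_pairwise_tuples_clique)
    fix v w
    assume vw: "v \<in> {w \<in> phi7_space p. phi7_comm p (a, b, c, d) w}"
      "w \<in> {w \<in> phi7_space p. phi7_comm p (a, b, c, d) w}"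
    show "phi7_comm p v w"
      by (rule phi7_comm_centralizer_generic[OF assms, of c d]) (use vw in \<open>simp_all only: mem_Collect_eq\<close>)
  qed simp
  thus ?thesis by (simp only: card_centralizer_generic[OF assms])
qed

text \<open>The first entry is either one of \<open>p\<close> points central in the centralizer
  \<open>?M\<close>, and leaves all of \<open>?M\<close>, or it leaves a commutative set of
  \<open>p\<^sup>2\<close> points. The count \<open>T\<close> thus satisfies
  \<open>T (n + 1) = (p^3 - p) p^(2 n) + p T n\<close> with \<open>T 0 = 1\<close>.\<close>

lemma card_tuples_special:
  assumes v: "(0, 0, c, d) \<in> phi7_space p" "(c, d) \<noteq> (0, 0)"
  shows "real (card (pairwise_tuples (phi7_comm p) {w \<in> phi7_space p. phi7_comm p (0, 0, c, d) w} n)) =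
    (real_of_int p + 1) * (real_of_int p ^ 2) ^ n - real_of_int p * real_of_int p ^ n"
proof (induction n)
  case (Suc n)
  let ?M = "{w \<in> phi7_space p. phi7_comm p (0, 0, c, d) w}"
  \<comment> \<open>These are the multiples of \<open>(0, 0, c, d)\<close> modulo
    \<open>p\<close>.\<close>
  let ?Z = "{(x, y, z, t) \<in> phi7_space p. (x = 0 \<and> y = 0) \<and> p dvd (- d) * z + c * t + 0}"
  let ?C = "\<lambda>x. {y \<in> ?M. phi7_comm p x y}"
  have cd: "\<not> (p dvd c \<and> p dvd d)"
    using v by (auto simp: phi7_space_def residue_zero_iff simp del: atLeastLessThan_iff)
  have cancel: "p dvd x" if "p dvd c * x" "p dvd d * x" for x
    using that cd prime_p by (auto simp: prime_dvd_mult_iff)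
  have central: "?C x = ?M" if xZ: "x \<in> ?Z" for x
  proof -
    obtain c' d' where x: "x = (0, 0, c', d')" "p dvd (- d) * c' + c * d'"
      using xZ by (cases x) auto
    have "phi7_comm p x y" if y: "y \<in> ?M" for y
    proof -
      obtain a1 b1 c1 d1 where y1: "y = (a1, b1, c1, d1)" by (cases y)
      obtain k where k: "(- d) * c' + c * d' = p * k" using x(2) unfolding dvd_def by blast
      obtain l where l: "d * b1 - a1 * c = p * l" using y unfolding y1 by (auto simp: dvd_def)
      \<comment> \<open>As \<open>(c', d')\<close> is proportional to \<open>(c, d)\<close>, one
        form vanishes with the other; multiplying by \<open>c\<close> and by \<open>d\<close> avoids
        asking which of them is invertible.\<close>
      have 1: "c * (d' * b1 - a1 * c') = p * (b1 * k + c' * l)" using k l by Groebner_Basis.algebra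
      have 2: "d * (d' * b1 - a1 * c') = p * (a1 * k + d' * l)" using k l by Groebner_Basis.algebra
      have "p dvd d' * b1 - a1 * c'" by (rule cancel) (simp_all only: 1 2 dvd_triv_left)
      thus ?thesis by (simp add: x y1)
    qed
    thus ?thesis by blast
  qed
  have noncentral: "card (pairwise_tuples (phi7_comm p) (?C x) n) = (nat p ^ 2) ^ n"
    if x: "x \<in> ?M - ?Z" for x
  proof -
    obtain a' b' c' d' where x': "x = (a', b', c', d')" by (cases x)
    show ?thesis
    proof (cases "a' = 0 \<and> b' = 0")
      case False
      hence ab: "\<not> (p dvd a' \<and> p dvd b')"
        using x by (auto simp: x' phi7_space_def residue_zero_iff simp del: atLeastLessThan_iff)
      \<comment> \<open>The full centralizer of \<open>x\<close> is commutative and contains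
        \<open>(0, 0, c, d)\<close>, so it already lies in \<open>?M\<close>.\<close>
      have "?C x = {w \<in> phi7_space p. phi7_comm p (a', b', c', d') w}"
        using x phi7_comm_centralizer_generic[OF ab] unfolding x' by (blast intro: phi7_comm_sym)
      thus ?thesis using card_tuples_generic[OF ab] by simp
    next
      case True
      hence nd: "\<not> p dvd (- d) * c' + c * d'" using x x' by auto
      have zero: "a1 = 0 \<and> b1 = 0" if y: "(a1, b1, c1, d1) \<in> ?C x" for a1 b1 c1 d1
      proof -
        have "p dvd d * b1 - a1 * c" "p dvd d' * b1 - a1 * c'"
          using y True by (auto simp: x')
        then obtain k l where k: "d * b1 - a1 * c = p * k" and l: "d' * b1 - a1 * c' = p * l"
          unfolding dvd_def by blast
        \<comment> \<open>Cramer's rule for two homogeneous congruences in \<open>a1\<close> and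
          \<open>b1\<close>, whose determinant up to sign is the quantity not divisible by
          \<open>p\<close>.\<close>
        have "((- d) * c' + c * d') * a1 = p * (d * l - d' * k)"
             "((- d) * c' + c * d') * b1 = p * (c * l - c' * k)"
          using k l by Groebner_Basis.algebra+
        hence "p dvd ((- d) * c' + c * d') * a1" "p dvd ((- d) * c' + c * d') * b1"
          by (simp_all only: dvd_triv_left)
        hence "p dvd a1" "p dvd b1" using nd prime_p prime_dvd_mult_iff by blast+
        thus ?thesis using y by (auto simp: phi7_space_def residue_zero_iff simp del: atLeastLessThan_iff)
      qed
      have "?C x = {0} \<times> {0} \<times> {0..<p} \<times> {0..<p}"
      proof
        show "?C x \<subseteq> {0} \<times> {0} \<times> {0..<p} \<times> {0..<p}"
        proof
          fix y assume y: "y \<in> ?C x"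
          obtain a1 b1 c1 d1 where y1: "y = (a1, b1, c1, d1)" by (cases y)
          show "y \<in> {0} \<times> {0} \<times> {0..<p} \<times> {0..<p}"
            using zero[OF y[unfolded y1]] y unfolding y1 by (simp add: phi7_space_def)
        qed
        show "{0} \<times> {0} \<times> {0..<p} \<times> {0..<p} \<subseteq> ?C x"
        proof
          fix y :: "int \<times> int \<times> int \<times> int"
          assume "y \<in> {0} \<times> {0} \<times> {0..<p} \<times> {0..<p}"
          then obtain c1 d1 where "y = (0, 0, c1, d1)" "c1 \<in> {0..<p}" "d1 \<in> {0..<p}" by blast
          thus "y \<in> ?C x" using True p_pos by (simp add: x' phi7_space_def)
        qed
      qed
      moreover have "card (pairwise_tuples (phi7_comm p) ({0} \<times> {0} \<times> {0..<p} \<times> {0..<p}) n) =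
          (nat p ^ 2) ^ n"
        by (subst card_pairwise_tuples_clique) (auto simp: card_cartesian_product power2_eq_square)
      ultimately show ?thesis by (simp only:)
    qed
  qed
  have q: "real (nat p) = real_of_int p" using p_pos by simp
  have ZM: "?Z \<subseteq> ?M" by auto
  have "\<not> (p dvd - d \<and> p dvd c)" using cd by auto
  hence lin: "card {(z, t) \<in> {0..<p} \<times> {0..<p}. p dvd (- d) * z + c * t + 0} = nat p"
    by (rule card_linear_solutions)
  have "{(x, y) \<in> {0..<p} \<times> {0..<p}. x = 0 \<and> y = 0} = {(0, 0)}" using p_pos by auto
  hence cZ: "card ?Z = nat p"
    unfolding card_phi7_space_split using lin by simp
  have finM: "finite ?M" by simp
  have "card (pairwise_tuples (phi7_comm p) ?M (Suc n)) =
      (\<Sum>x\<in>?M. card (pairwise_tuples (phi7_comm p) (?C x) n))"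
    by (rule card_pairwise_tuples_Suc) (auto simp: phi7_comm_refl dest: phi7_comm_sym)
  also have "\<dots> = (\<Sum>x\<in>?M - ?Z. card (pairwise_tuples (phi7_comm p) (?C x) n))
      + (\<Sum>x\<in>?Z. card (pairwise_tuples (phi7_comm p) (?C x) n))"
    by (rule sum.subset_diff[OF ZM finM])
  also have "\<dots> = (\<Sum>x\<in>?M - ?Z. (nat p ^ 2) ^ n)
      + (\<Sum>x\<in>?Z. card (pairwise_tuples (phi7_comm p) ?M n))"
    by (simp only: noncentral central cong: sum.cong)
  also have "\<dots> = card (?M - ?Z) * (nat p ^ 2) ^ n + card ?Z * card (pairwise_tuples (phi7_comm p) ?M n)"
    by (simp only: sum_constant of_nat_id)
  finally have step: "real (card (pairwise_tuples (phi7_comm p) ?M (Suc n))) =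
      real (card (?M - ?Z)) * (real_of_int p ^ 2) ^ n
      + real_of_int p * real (card (pairwise_tuples (phi7_comm p) ?M n))"
    by (simp only: of_nat_add of_nat_mult of_nat_power cZ q)
  have "real (card (?M - ?Z)) = real (nat p ^ 3) - real (nat p)"
    using card_mono[OF finM ZM]
    by (simp only: card_Diff_subset[OF finite_subset[OF ZM finM] ZM] of_nat_diff cZ
        card_centralizer_special[OF cd])
  hence cMZ: "real (card (?M - ?Z)) = real_of_int p ^ 3 - real_of_int p"
    by (simp only: q of_nat_power)
  show ?case
    unfolding step Suc.IH cMZ by (simp add: algebra_simps power2_eq_square power3_eq_cube)
qed simp

text \<open>Recursion over the first entry again: the origin gives back the whole space, and the
  other two types contribute the counts already found.\<close>

lemma card_tuples_phi7:
  "real (card (pairwise_tuples (phi7_comm p) (phi7_space p) n)) =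
    (1 + real_of_int p + real_of_int p ^ 2) * (real_of_int p ^ 2) ^ n
      - (real_of_int p ^ 2 + real_of_int p) * real_of_int p ^ n"
proof (induction n)
  case (Suc n)
  let ?T = "\<lambda>v. pairwise_tuples (phi7_comm p) {w \<in> phi7_space p. phi7_comm p v w} n"
  have "real (card (pairwise_tuples (phi7_comm p) (phi7_space p) (Suc n))) =
      (\<Sum>v\<in>phi7_space p. real (card (?T v)))"
    by (subst card_pairwise_tuples_Suc) (auto simp: phi7_comm_refl dest: phi7_comm_sym)
  also have "\<dots> = real (card (pairwise_tuples (phi7_comm p) (phi7_space p) n))
      + (real_of_int p ^ 2 - 1) *
        ((real_of_int p + 1) * (real_of_int p ^ 2) ^ n - real_of_int p * real_of_int p ^ n)
      + (real_of_int p ^ 4 - real_of_int p ^ 2) * (real_of_int p ^ 2) ^ n"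
  proof (rule sum_phi7_space)
    have "{w \<in> phi7_space p. phi7_comm p (0, 0, 0, 0) w} = phi7_space p" by auto
    thus "real (card (?T (0, 0, 0, 0))) =
        real (card (pairwise_tuples (phi7_comm p) (phi7_space p) n))"
      by simp
  next
    fix a b c d assume "(a, b, c, d) \<in> phi7_space p" "(a, b) \<noteq> (0, 0)"
    hence "\<not> (p dvd a \<and> p dvd b)"
      by (auto simp: phi7_space_def residue_zero_iff simp del: atLeastLessThan_iff)
    thus "real (card (?T (a, b, c, d))) = (real_of_int p ^ 2) ^ n"
      using p_pos by (simp add: card_tuples_generic)
  qed (rule card_tuples_special)
  finally show ?case
    unfolding Suc.IH by (simp add: algebra_simps power2_eq_square power4_eq_xxxx)
qed simp

end

subsection \<open>Exponent vectors of words\<close>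

text \<open>\<open>(a, d, b, c, e)\<close> stands for \<open>\<alpha>\<^sup>a \<beta>\<^sup>d \<alpha>\<^sub>1\<^sup>b \<alpha>\<^sub>2\<^sup>c \<alpha>\<^sub>3\<^sup>e\<close>; a letter acts by multiplication from the right.\<close>

type_synonym phi7_exps = "int \<times> int \<times> int \<times> int \<times> int"

fun phi7_step :: "phi7_gen \<times> bool \<Rightarrow> phi7_exps \<Rightarrow> phi7_exps" where
  "phi7_step (Al, True) (a, d, b, c, e) = (a + 1, d, b, b + c, c + e)"
| "phi7_step (Al, False) (a, d, b, c, e) = (a - 1, d, b, c - b, e - c + b)"
| "phi7_step (Be, True) (a, d, b, c, e) = (a, d + 1, b, c, b + e)"
| "phi7_step (Be, False) (a, d, b, c, e) = (a, d - 1, b, c, e - b)"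
| "phi7_step (Al1, True) (a, d, b, c, e) = (a, d, b + 1, c, e)"
| "phi7_step (Al1, False) (a, d, b, c, e) = (a, d, b - 1, c, e)"
| "phi7_step (Al2, True) (a, d, b, c, e) = (a, d, b, c + 1, e)"
| "phi7_step (Al2, False) (a, d, b, c, e) = (a, d, b, c - 1, e)"
| "phi7_step (Al3, True) (a, d, b, c, e) = (a, d, b, c, e + 1)"
| "phi7_step (Al3, False) (a, d, b, c, e) = (a, d, b, c, e - 1)"

text \<open>Exponents are kept as integers; the relations on \<open>p\<close>-th powers enter only
  through the congruence \<open>phi7_cong\<close>.\<close>

definition phi7_exponents :: "phi7_gen word \<Rightarrow> phi7_exps" where
  "phi7_exponents w = fold phi7_step w (0, 0, 0, 0, 0)"

text \<open>The binomial coefficient \<open>a choose 2\<close>, extended to negative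
  \<open>a\<close>.\<close>

definition binom2 :: "int \<Rightarrow> int" where
  "binom2 a = a * (a - 1) div 2"

text \<open>Moving \<open>a'\<close> letters \<alpha> to the left past \<open>b\<close> letters
  \<open>\<alpha>\<^sub>1\<close> creates \<open>b * a'\<close> letters
  \<open>\<alpha>\<^sub>2\<close> and \<open>b * binom2 a'\<close> letters
  \<open>\<alpha>\<^sub>3\<close>; passing \<open>\<alpha>\<^sub>2\<close> adds
  \<open>c * a'\<close> letters \<open>\<alpha>\<^sub>3\<close>, and moving \<beta> past
  \<open>\<alpha>\<^sub>1\<close> adds \<open>b * d'\<close>.\<close>

fun phi7_mult :: "phi7_exps \<Rightarrow> phi7_exps \<Rightarrow> phi7_exps" where
  "phi7_mult (a, d, b, c, e) (a', d', b', c', e') =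
     (a + a', d + d', b + b', c + c' + b * a', e + e' + c * a' + b * (binom2 a' + d'))"

lemma two_binom2: "2 * binom2 a = a * (a - 1)"
  by (simp add: binom2_def)

lemma binom2_0 [simp]: "binom2 0 = 0" by (simp add: binom2_def)

lemma binom2_plus_1: "binom2 (a + 1) = binom2 a + a"
  using two_binom2[of a] two_binom2[of "a + 1"] by (simp add: algebra_simps)

lemma binom2_minus_1: "binom2 (a - 1) = binom2 a - a + 1"
  using binom2_plus_1[of "a - 1"] by simp

text \<open>The instance of associativity used in the induction on the right-hand word; the letter
  \<alpha> rests on the recurrence of \<open>binom2\<close>.\<close>

lemma phi7_step_mult: "phi7_step x (phi7_mult s t) = phi7_mult s (phi7_step x t)"
proof -
  obtain a d b c e where s: "s = (a, d, b, c, e)" by (cases s)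
  obtain a' d' b' c' e' where t: "t = (a', d', b', c', e')" by (cases t)
  obtain g y where x: "x = (g, y)" by (cases x)
  have "binom2 (1 + a') = binom2 a' + a'" using binom2_plus_1[of a'] by (simp add: add.commute)
  thus ?thesis
    by (cases g; cases y) (simp_all add: x s t binom2_minus_1 algebra_simps)
qed

lemma phi7_exponents_append:
  "phi7_exponents (u @ v) = phi7_mult (phi7_exponents u) (phi7_exponents v)"
proof (induction v rule: rev_induct)
  case Nil
  show ?case by (cases "phi7_exponents u") (simp add: phi7_exponents_def[of "[]"])
next
  case (snoc x v)
  have snoc_eq: "phi7_exponents (w @ [x]) = phi7_step x (phi7_exponents w)" for w
    by (simp add: phi7_exponents_def)
  have "phi7_exponents (u @ v @ [x]) = phi7_step x (phi7_exponents (u @ v))"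
    using snoc_eq[of "u @ v"] by simp
  thus ?case by (simp add: snoc.IH snoc_eq phi7_step_mult)
qed

lemma phi7_exponents_pow:
  "phi7_exponents (word_pow (gen Al) n) = (int n, 0, 0, 0, 0)"
  "phi7_exponents (word_pow (gen Be) n) = (0, int n, 0, 0, 0)"
  "phi7_exponents (word_pow (gen Al1) n) = (0, 0, int n, 0, 0)"
  "phi7_exponents (word_pow (gen Al2) n) = (0, 0, 0, int n, 0)"
  "phi7_exponents (word_pow (gen Al3) n) = (0, 0, 0, 0, int n)"
proof -
  have pow: "phi7_exponents (word_pow (gen x) (Suc n)) =
      phi7_step (x, True) (phi7_exponents (word_pow (gen x) n))" for x n
  proof -
    have "word_pow (gen x) (Suc n) = word_pow (gen x) n @ [(x, True)]"
      by (simp add: word_pow_def gen_def replicate_append_same[symmetric] del: replicate_append_same)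
    thus ?thesis by (simp add: phi7_exponents_def)
  qed
  have zero: "phi7_exponents (word_pow (gen x) 0) = (0, 0, 0, 0, 0)" for x
    by (simp add: word_pow_def phi7_exponents_def)
  show "phi7_exponents (word_pow (gen Al) n) = (int n, 0, 0, 0, 0)"
    "phi7_exponents (word_pow (gen Be) n) = (0, int n, 0, 0, 0)"
    "phi7_exponents (word_pow (gen Al1) n) = (0, 0, int n, 0, 0)"
    "phi7_exponents (word_pow (gen Al2) n) = (0, 0, 0, int n, 0)"
    "phi7_exponents (word_pow (gen Al3) n) = (0, 0, 0, 0, int n)"
    by (induction n) (simp_all add: pow zero)
qed

text \<open>Since \<open>p\<close> divides \<open>p choose 2\<close>, the relation for \<open>\<alpha>\<^sub>1\<^sup>p\<close> says
  \<open>\<alpha>\<^sub>1 ^ p = \<alpha>\<^sub>3 ^ (- (p choose 3))\<close>; this is nontrivial for \<open>p = 3\<close>.\<close>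

fun phi7_cong :: "nat \<Rightarrow> phi7_exps \<Rightarrow> phi7_exps \<Rightarrow> bool" where
  "phi7_cong p (a, d, b, c, e) (a', d', b', c', e') \<longleftrightarrow>
     int p dvd a - a' \<and> int p dvd d - d' \<and> int p dvd c - c' \<and>
     (\<exists>k. b - b' = int p * k \<and> int p dvd e - e' - k * int (p choose 3))"

lemma phi7_cong_refl: "phi7_cong p s s"
  by (cases s) auto

lemma phi7_cong_sym: "phi7_cong p s t \<Longrightarrow> phi7_cong p t s"
proof (cases s; cases t)
  fix a d b c e a' d' b' c' e'
  assume st: "s = (a, d, b, c, e)" "t = (a', d', b', c', e')" and "phi7_cong p s t"
  then obtain k where h: "int p dvd a - a'" "int p dvd d - d'" "int p dvd c - c'"
    "b - b' = int p * k" "int p dvd e - e' - k * int (p choose 3)" by auto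
  have "b' - b = int p * (- k)" using h(4) by simp
  moreover have "int p dvd e' - e - (- k) * int (p choose 3)"
    using h(5) by (subst dvd_minus_iff[symmetric]) (simp add: algebra_simps)
  ultimately show "phi7_cong p t s" using h(1-3) unfolding st phi7_cong.simps
    by (metis dvd_minus_iff minus_diff_eq)
qed

lemma phi7_cong_trans: "phi7_cong p s t \<Longrightarrow> phi7_cong p t u \<Longrightarrow> phi7_cong p s u"
proof (cases s; cases t; cases u)
  fix a d b c e a' d' b' c' e' a2 d2 b2 c2 e2
  assume st: "s = (a, d, b, c, e)" "t = (a', d', b', c', e')" "u = (a2, d2, b2, c2, e2)"
    and "phi7_cong p s t" "phi7_cong p t u"
  then obtain k l where h: "int p dvd a - a'" "int p dvd d - d'" "int p dvd c - c'"
    "b - b' = int p * k" "int p dvd e - e' - k * int (p choose 3)"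
    "int p dvd a' - a2" "int p dvd d' - d2" "int p dvd c' - c2"
    "b' - b2 = int p * l" "int p dvd e' - e2 - l * int (p choose 3)" by auto
  have "b - b2 = int p * (k + l)" using h(4,9) by (simp add: algebra_simps)
  moreover have "int p dvd e - e2 - (k + l) * int (p choose 3)"
    using dvd_add[OF h(5,10)] by (simp add: algebra_simps)
  moreover have "int p dvd a - a2" "int p dvd d - d2" "int p dvd c - c2"
    using dvd_add[OF h(1,6)] dvd_add[OF h(2,7)] dvd_add[OF h(3,8)] by simp_all
  ultimately show "phi7_cong p s u" unfolding st phi7_cong.simps by blast
qed

section \<open>The exponent congruence and the defining relations\<close>

lemma dvd_diff_mult: "m dvd x - x' \<Longrightarrow> m dvd y - y' \<Longrightarrow> m dvd x * y - x' * y'" for m :: int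
  using dvd_add[OF dvd_mult[of m "y - y'" x] dvd_mult2[of m "x - x'" y']]
  by (simp add: algebra_simps)

context
  fixes p :: nat
  assumes prime_p: "Factorial_Ring.prime p" and odd_p: "odd p"
begin

lemma prime_of_nat_p: "Factorial_Ring.prime (int p)"
  using prime_p by simp

text \<open>\<open>binom2\<close> is a polynomial with denominator 2, and 2 can be cancelled modulo
  an odd prime.\<close>

lemma binom2_cong:
  assumes "int p dvd a - a'"
  shows "int p dvd binom2 a - binom2 a'"
proof -
  have "int p dvd a * (a - 1) - a' * (a' - 1)"
    using assms by (intro dvd_diff_mult) simp_all
  hence "int p dvd 2 * (binom2 a - binom2 a')"
    by (simp add: right_diff_distrib two_binom2)
  moreover have "\<not> int p dvd 2"
    using odd_p prime_p by (metis even_numeral int_dvd_int_iff of_nat_numeral primes_dvd_imp_eq two_is_prime_nat)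
  ultimately show ?thesis using prime_of_nat_p prime_dvd_mult_iff by blast
qed

lemma p_dvd_choose_2: "p dvd p choose 2"
  using prime_p odd_p
  by (intro dvd_choose_prime) (auto simp: prime_gt_0_nat intro: le_neq_trans[OF prime_ge_2_nat])

lemma phi7_mult_cong:
  assumes "phi7_cong p s s'" "phi7_cong p t t'"
  shows "phi7_cong p (phi7_mult s t) (phi7_mult s' t')"
proof -
  obtain a d b c e where s: "s = (a, d, b, c, e)" by (cases s)
  obtain a' d' b' c' e' where t: "t = (a', d', b', c', e')" by (cases t)
  obtain a1 d1 b1 c1 e1 where s': "s' = (a1, d1, b1, c1, e1)" by (cases s')
  obtain a2 d2 b2 c2 e2 where t': "t' = (a2, d2, b2, c2, e2)" by (cases t')
  obtain k l where h: "int p dvd a - a1" "int p dvd d - d1" "int p dvd c - c1"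
    "b - b1 = int p * k" "int p dvd e - e1 - k * int (p choose 3)"
    "int p dvd a' - a2" "int p dvd d' - d2" "int p dvd c' - c2"
    "b' - b2 = int p * l" "int p dvd e' - e2 - l * int (p choose 3)"
    using assms by (auto simp: s t s' t')
  have b: "int p dvd b - b1" by (simp add: h(4))
  have "int p dvd (binom2 a' + d') - (binom2 a2 + d2)"
    using dvd_add[OF binom2_cong[OF h(6)] h(7)] by (simp add: algebra_simps)
  note e = dvd_add[OF dvd_add[OF h(5,10)] dvd_add[OF dvd_diff_mult[OF h(3,6)] dvd_diff_mult[OF b this]]]
  \<comment> \<open>Exponents of \<open>\<alpha>\<^sub>1\<close> add, so the carries
    \<open>k\<close> and \<open>l\<close> into the exponent of \<open>\<alpha>\<^sub>3\<close> add
    as well.\<close>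
  have "(b + b') - (b1 + b2) = int p * (k + l)" using h(4,9) by (simp add: algebra_simps)
  moreover have "int p dvd (e + e' + c * a' + b * (binom2 a' + d'))
      - (e1 + e2 + c1 * a2 + b1 * (binom2 a2 + d2)) - (k + l) * int (p choose 3)"
    using e by (simp add: algebra_simps)
  moreover have "int p dvd (a + a') - (a1 + a2)" "int p dvd (d + d') - (d1 + d2)"
    "int p dvd (c + c' + b * a') - (c1 + c2 + b1 * a2)"
    using dvd_add[OF h(1,6)] dvd_add[OF h(2,7)]
      dvd_add[OF dvd_add[OF h(3,8)] dvd_diff_mult[OF b h(6)]] by (simp_all add: algebra_simps)
  ultimately show ?thesis unfolding s s' t t' phi7_mult.simps phi7_cong.simps by blast
qed

text \<open>The congruence is compatible with concatenation, so it suffices to check the relations.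
  This bounds the presented group from below: words with incongruent exponents stay
  distinct.\<close>

lemma phi7_cong_if_pres_eq:
  assumes "pres_eq (phi7_relations p) u v"
  shows "phi7_cong p (phi7_exponents u) (phi7_exponents v)"
  using assms
proof induction
  case (append u v u' v')
  thus ?case by (simp add: phi7_exponents_append phi7_mult_cong)
next
  case (cancel x b)
  have "phi7_exponents [(x, b), (x, \<not> b)] = phi7_exponents []"
    by (cases x; cases b) (simp_all add: phi7_exponents_def)
  thus ?case by (simp add: phi7_cong_refl)
next
  case (rel u v)
  consider (c) x y z where "u = word_commutator (gen x) (gen y)" "v = gen z"
      "(x, y, z) \<in> phi7_commutators"
    | (t) x y where "u = word_commutator (gen x) (gen y)" "v = []"
      "\<forall>z. (x, y, z) \<notin> phi7_commutators \<and> (y, x, z) \<notin> phi7_commutators"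
    | (pow) "v = []" "u \<in> {word_pow (gen Al) p,
      word_pow (gen Al1) p @ word_pow (gen Al2) (p choose 2) @ word_pow (gen Al3) (p choose 3),
      word_pow (gen Al2) p, word_pow (gen Al3) p, word_pow (gen Be) p}"
    using rel unfolding phi7_relations_def by blast
  thus ?case
  proof cases
    \<comment> \<open>The commutator relations hold already for integer exponents; only the power
      relations use the congruence.\<close>
    case c
    hence "phi7_exponents u = phi7_exponents v"
      by (auto simp: phi7_commutators_def phi7_exponents_def word_commutator_def word_inv_def gen_def)
    thus ?thesis by (simp add: phi7_cong_refl)
  next
    case t
    hence "phi7_exponents u = phi7_exponents v"
      by (cases x; cases y)
        (auto simp: phi7_commutators_def phi7_exponents_def word_commutator_def word_inv_def gen_def)
    thus ?thesis by (simp add: phi7_cong_refl)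
  next
    case pow
    \<comment> \<open>For the relation on \<open>\<alpha>\<^sub>1\<close> the carry is 1, which
      removes the exponent \<open>p choose 3\<close> exactly.\<close>
    have "int p dvd int (p choose 2)" using p_dvd_choose_2 by simp
    moreover have "phi7_exponents [] = (0, 0, 0, 0, 0)" by (simp add: phi7_exponents_def)
    moreover have "p \<noteq> 0" using prime_p by auto
    ultimately show ?thesis
      using pow by (auto simp: phi7_exponents_append phi7_exponents_pow)
  qed
qed (blast intro: phi7_cong_refl phi7_cong_sym phi7_cong_trans)+

end

subsection \<open>Normal forms in the presented group\<close>

lemma (in group) int_pow_conj:
  assumes x: "x \<in> carrier G" and y: "y \<in> carrier G" and g: "g \<in> carrier G"
    and xg: "x \<otimes> g = g \<otimes> y"
  shows "x [^] (n::int) \<otimes> g = g \<otimes> y [^] n"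
proof -
  have nat_case: "x [^] k \<otimes> g = g \<otimes> y [^] k" for k :: nat
  proof (induction k)
    case (Suc k)
    have "x [^] Suc k \<otimes> g = x [^] k \<otimes> (g \<otimes> y)" using x g by (simp add: m_assoc xg)
    also have "\<dots> = g \<otimes> y [^] Suc k" using x y g Suc by (simp add: m_assoc[symmetric])
    finally show ?case .
  qed (use g in simp)
  show ?thesis
  proof (cases n)
    case (nonneg k)
    thus ?thesis using nat_case by (simp add: int_pow_int)
  next
    case (neg k)
    have "inv (x [^] m) \<otimes> g = g \<otimes> inv (y [^] m)" for m :: nat
    proof -
      have "g = inv (x [^] m) \<otimes> (x [^] m \<otimes> g)" using x g by (simp add: m_assoc[symmetric])
      also have "\<dots> = inv (x [^] m) \<otimes> g \<otimes> y [^] m" using x y g by (simp add: nat_case m_assoc)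
      finally have "g \<otimes> inv (y [^] m) = inv (x [^] m) \<otimes> g \<otimes> y [^] m \<otimes> inv (y [^] m)" by simp
      thus ?thesis using x y g by (simp add: m_assoc)
    qed
    thus ?thesis using x y by (simp only: neg int_pow_neg_int)
  qed
qed

text \<open>A relation \<open>[x, y] = z\<close> is recorded as \<open>x y = y (x z)\<close>, ready
  for moving \<open>y\<close> to the left past powers of \<open>x\<close>.\<close>

locale phi7_generators = group G for G (structure) +
  fixes p :: nat and A A1 A2 A3 B
  assumes gens: "A \<in> carrier G" "A1 \<in> carrier G" "A2 \<in> carrier G" "A3 \<in> carrier G" "B \<in> carrier G"
    and A1_A: "A1 \<otimes> A = A \<otimes> (A1 \<otimes> A2)" and A2_A: "A2 \<otimes> A = A \<otimes> (A2 \<otimes> A3)"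
    and A1_B: "A1 \<otimes> B = B \<otimes> (A1 \<otimes> A3)"
    and A3_A: "A3 \<otimes> A = A \<otimes> A3" and A3_B: "A3 \<otimes> B = B \<otimes> A3" and A2_B: "A2 \<otimes> B = B \<otimes> A2"
    and B_A: "B \<otimes> A = A \<otimes> B"
    and A2_A1: "A2 \<otimes> A1 = A1 \<otimes> A2" and A3_A1: "A3 \<otimes> A1 = A1 \<otimes> A3"
    and A3_A2: "A3 \<otimes> A2 = A2 \<otimes> A3"
    and pows: "A [^] p = \<one>" "A2 [^] p = \<one>" "A3 [^] p = \<one>" "B [^] p = \<one>"
      "A1 [^] p \<otimes> A2 [^] (p choose 2) \<otimes> A3 [^] (p choose 3) = \<one>"
    and p_choose_2: "p dvd p choose 2"
begin

fun normal_form :: "phi7_exps \<Rightarrow> 'a" where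
  "normal_form (a, d, b, c, e) =
     A [^] a \<otimes> (B [^] d \<otimes> (A1 [^] b \<otimes> (A2 [^] c \<otimes> A3 [^] e)))"

definition letter :: "phi7_gen \<Rightarrow> 'a" where
  "letter x = (case x of Al \<Rightarrow> A | Al1 \<Rightarrow> A1 | Al2 \<Rightarrow> A2 | Al3 \<Rightarrow> A3 | Be \<Rightarrow> B)"

lemma letter_closed [simp]: "letter x \<in> carrier G"
  by (cases x) (simp_all add: letter_def gens)

lemma normal_form_closed [simp]: "normal_form s \<in> carrier G"
  by (cases s) (simp add: gens)

lemma pow_move:
  assumes "x \<in> carrier G" "y \<in> carrier G" "g \<in> carrier G" "z \<in> carrier G" "x \<otimes> g = g \<otimes> y"
  shows "x [^] (n::int) \<otimes> (g \<otimes> z) = g \<otimes> (y [^] n \<otimes> z)"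
  using int_pow_conj[OF assms(1-3,5)] assms(1-4) by (simp add: m_assoc[symmetric])

lemma pow_plus_1: "x \<in> carrier G \<Longrightarrow> z \<in> carrier G \<Longrightarrow> x [^] (n::int) \<otimes> (x \<otimes> z) = x [^] (n + 1) \<otimes> z"
  by (simp add: int_pow_mult m_assoc)

lemma pow_plus: "x \<in> carrier G \<Longrightarrow> z \<in> carrier G \<Longrightarrow>
    x [^] (n::int) \<otimes> (x [^] m \<otimes> z) = x [^] (n + m) \<otimes> z"
  by (simp add: int_pow_mult m_assoc)

text \<open>The letter moves left to its place. On the way \<open>A\<close> turns \<open>A1\<close>
  into \<open>A1 A2\<close> and \<open>A2\<close> into \<open>A2 A3\<close>, and \<open>B\<close>
  turns \<open>A1\<close> into \<open>A1 A3\<close>; collecting powers reproduces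
  \<open>phi7_step\<close>.\<close>

lemma normal_form_letter:
  "normal_form s \<otimes> letter x = normal_form (phi7_step (x, True) s)"
proof -
  obtain a d b c e where s: "s = (a, d, b, c, e)" by (cases s)
  note [simp] = gens s letter_def
  have A3: "A3 [^] e \<otimes> g = g \<otimes> A3 [^] e" if "g \<in> {A, A1, A2, B}" for g
    using that A3_A A3_A1 A3_A2 A3_B by (intro int_pow_conj) auto
  have "A2 [^] c \<otimes> A3 [^] c' = A3 [^] c' \<otimes> A2 [^] c" for c' :: int
  proof -
    have "A3 [^] c' \<otimes> A2 = A2 \<otimes> A3 [^] c'" by (rule int_pow_conj) (simp_all add: A3_A2)
    thus ?thesis by (intro int_pow_conj) simp_all
  qed
  note A2_A3 = this
  have A1A2: "(A1 \<otimes> A2) [^] b = A1 [^] b \<otimes> A2 [^] b"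
    by (rule int_pow_mult_distrib) (simp_all add: A2_A1)
  have A2A3: "(A2 \<otimes> A3) [^] c = A2 [^] c \<otimes> A3 [^] c"
    by (rule int_pow_mult_distrib) (simp_all add: A3_A2)
  have A1A3: "(A1 \<otimes> A3) [^] b = A1 [^] b \<otimes> A3 [^] b"
    by (rule int_pow_mult_distrib) (simp_all add: A3_A1)
  show ?thesis
  proof (cases x)
    case Al
    have "normal_form s \<otimes> A = A [^] a \<otimes> (B [^] d \<otimes> (A1 [^] b \<otimes> (A2 [^] c \<otimes> (A \<otimes> A3 [^] e))))"
      by (simp add: m_assoc A3)
    also have "\<dots> = A [^] a \<otimes> (A \<otimes> (B [^] d \<otimes> ((A1 \<otimes> A2) [^] b \<otimes> ((A2 \<otimes> A3) [^] c \<otimes> A3 [^] e))))"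
      by (simp add: pow_move[OF _ _ _ _ A2_A] pow_move[OF _ _ _ _ A1_A] pow_move[OF _ _ _ _ B_A])
    also have "\<dots> = normal_form (phi7_step (Al, True) s)"
      by (simp add: A1A2 A2A3 m_assoc pow_plus_1 pow_plus int_pow_mult[symmetric])
    finally show ?thesis by (simp add: Al)
  next
    case Be
    have "normal_form s \<otimes> B = A [^] a \<otimes> (B [^] d \<otimes> (A1 [^] b \<otimes> (A2 [^] c \<otimes> (B \<otimes> A3 [^] e))))"
      by (simp add: m_assoc A3)
    also have "\<dots> = A [^] a \<otimes> (B [^] d \<otimes> (B \<otimes> ((A1 \<otimes> A3) [^] b \<otimes> (A2 [^] c \<otimes> A3 [^] e))))"
      by (simp add: pow_move[OF _ _ _ _ A2_B] pow_move[OF _ _ _ _ A1_B])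
    also have "\<dots> = A [^] a \<otimes> (B [^] (d + 1) \<otimes> (A1 [^] b \<otimes> ((A3 [^] b \<otimes> A2 [^] c) \<otimes> A3 [^] e)))"
      by (simp add: A1A3 m_assoc pow_plus_1)
    also have "\<dots> = normal_form (phi7_step (Be, True) s)"
      by (simp add: A2_A3[symmetric] m_assoc int_pow_mult[symmetric])
    finally show ?thesis by (simp add: Be)
  next
    case Al1
    have "normal_form s \<otimes> A1 = A [^] a \<otimes> (B [^] d \<otimes> (A1 [^] b \<otimes> (A2 [^] c \<otimes> (A1 \<otimes> A3 [^] e))))"
      by (simp add: m_assoc A3)
    also have "\<dots> = normal_form (phi7_step (Al1, True) s)"
      by (simp add: pow_move[OF _ _ _ _ A2_A1] pow_plus_1)
    finally show ?thesis by (simp add: Al1)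
  next
    case Al2
    have "normal_form s \<otimes> A2 = A [^] a \<otimes> (B [^] d \<otimes> (A1 [^] b \<otimes> (A2 [^] c \<otimes> (A2 \<otimes> A3 [^] e))))"
      by (simp add: m_assoc A3)
    also have "\<dots> = normal_form (phi7_step (Al2, True) s)"
      by (simp add: pow_plus_1)
    finally show ?thesis by (simp add: Al2)
  next
    case Al3
    thus ?thesis by (simp add: m_assoc int_pow_mult)
  qed
qed

text \<open>The step for an inverse letter undoes the step for the letter, so cancellation in the
  positive case suffices.\<close>

lemma normal_form_letter_inv:
  "normal_form s \<otimes> inv (letter x) = normal_form (phi7_step (x, False) s)"
proof -
  have "s = phi7_step (x, True) (phi7_step (x, False) s)"
    by (cases s; cases x) simp_all
  hence "normal_form s = normal_form (phi7_step (x, False) s) \<otimes> letter x"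
    by (metis normal_form_letter)
  thus ?thesis by (simp add: m_assoc)
qed

lemma pow_cong:
  assumes "x \<in> carrier G" "x [^] p = \<one>" "int p dvd n - m"
  shows "x [^] n = x [^] m"
proof -
  obtain k where k: "n = m + int p * k" using assms(3) by (auto simp: dvd_def algebra_simps)
  have "x [^] (int p * k) = \<one>"
    using assms(1,2) by (simp add: int_pow_pow[symmetric] int_pow_int)
  thus ?thesis using assms(1) by (simp add: k int_pow_mult)
qed

text \<open>The exponents of \<open>A\<close>, \<open>B\<close> and \<open>A2\<close> matter only
  modulo \<open>p\<close>; a surplus \<open>p * k\<close> in the exponent of \<open>A1\<close> is
  traded for \<open>A3\<close> to the power \<open>- (k * (p choose 3))\<close>.\<close>

lemma normal_form_cong:
  assumes "phi7_cong p s t"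
  shows "normal_form s = normal_form t"
proof -
  obtain a d b c e where s: "s = (a, d, b, c, e)" by (cases s)
  obtain a' d' b' c' e' where t: "t = (a', d', b', c', e')" by (cases t)
  obtain k where h: "int p dvd a - a'" "int p dvd d - d'" "int p dvd c - c'"
    "b - b' = int p * k" "int p dvd e - e' - k * int (p choose 3)"
    using assms by (auto simp: s t)
  note [simp] = gens
  let ?m = "int (p choose 3)"
  have A3_pow: "A3 [^] n \<otimes> A2 [^] l = A2 [^] l \<otimes> A3 [^] n" for n l :: int
  proof -
    have "A2 [^] l \<otimes> A3 = A3 \<otimes> A2 [^] l" by (rule int_pow_conj) (simp_all add: A3_A2)
    thus ?thesis by (intro int_pow_conj) simp_all
  qed
  have "A2 [^] (p choose 2) = \<one>"
    using pow_cong[of A2 "int (p choose 2)" 0] pows(2) p_choose_2 by (simp add: int_pow_int)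
  hence "A1 [^] p \<otimes> A3 [^] ?m = \<one>" using pows(5) by (simp add: int_pow_int)
  hence "A1 [^] int p = inv (A3 [^] ?m)"
    by (subst inv_equality[symmetric, of "A1 [^] int p"]) (simp_all add: int_pow_int)
  hence "A1 [^] int p = A3 [^] (- ?m)" by (simp add: int_pow_neg)
  hence "A1 [^] (int p * k) = A3 [^] (- (k * ?m))"
    by (simp add: int_pow_pow[symmetric]) (simp add: int_pow_pow mult.commute)
  moreover have "b = b' + int p * k" using h(4) by simp
  ultimately have A1b: "A1 [^] b = A1 [^] b' \<otimes> A3 [^] (- (k * ?m))" by (simp add: int_pow_mult)
  have "A2 [^] c = A2 [^] c'" using pow_cong[OF _ pows(2) h(3)] by simp
  hence "A1 [^] b \<otimes> (A2 [^] c \<otimes> A3 [^] e) =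
      A1 [^] b' \<otimes> ((A3 [^] (- (k * ?m)) \<otimes> A2 [^] c') \<otimes> A3 [^] e)"
    by (simp add: A1b m_assoc)
  also have "\<dots> = A1 [^] b' \<otimes> (A2 [^] c' \<otimes> A3 [^] (e - k * ?m))"
    by (simp add: A3_pow m_assoc int_pow_mult[symmetric] algebra_simps)
  also have "A3 [^] (e - k * ?m) = A3 [^] e'"
    using h(5) by (intro pow_cong[OF _ pows(3)]) (simp_all add: algebra_simps)
  finally show ?thesis
    using pow_cong[OF _ pows(1) h(1)] pow_cong[OF _ pows(4) h(2)] by (simp add: s t)
qed

end

section \<open>Words as elements of the presented group\<close>

lemma pres_class_closed: "pres_class R w \<in> carrier (presented_group R)"
  by (simp add: presented_group_def)

lemma pres_class_Nil: "pres_class R [] = \<one>\<^bsub>presented_group R\<^esub>"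
  by (simp add: presented_group_def)

lemma pres_class_word_inv:
  "pres_class R (word_inv w) = inv\<^bsub>presented_group R\<^esub> (pres_class R w)"
proof -
  interpret group "presented_group R" by (rule group_presented_group)
  have "pres_class R (word_inv w) \<otimes>\<^bsub>presented_group R\<^esub> pres_class R w = \<one>\<^bsub>presented_group R\<^esub>"
    unfolding presented_group_mult pres_class_Nil[symmetric] pres_class_eq_iff
    by (rule pres_eq_word_inv)
  thus ?thesis by (intro inv_equality[symmetric] pres_class_closed)
qed

lemma pres_class_word_pow:
  "pres_class R (word_pow w n) = pres_class R w [^]\<^bsub>presented_group R\<^esub> n"
proof (induction n)
  case 0
  show ?case by (simp add: word_pow_def pres_class_Nil)
next
  case (Suc n)
  have "word_pow w (Suc n) = word_pow w n @ w"
    by (simp add: word_pow_def replicate_append_same[symmetric] del: replicate_append_same)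
  thus ?case using Suc by (simp add: presented_group_mult[symmetric] nat_pow_def)
qed

lemma pres_class_commutator:
  assumes "(word_commutator u v, w) \<in> R"
  shows "pres_class R u \<otimes>\<^bsub>presented_group R\<^esub> pres_class R v =
    pres_class R v \<otimes>\<^bsub>presented_group R\<^esub> (pres_class R u \<otimes>\<^bsub>presented_group R\<^esub> pres_class R w)"
proof -
  let ?P = "presented_group R"
  interpret group ?P by (rule group_presented_group)
  note [simp] = pres_class_closed
  have "pres_class R w = pres_class R (word_commutator u v)"
    using pres_eq.rel[OF assms] by (simp add: pres_class_eq_iff pres_eq.sym)
  also have "\<dots> = inv\<^bsub>?P\<^esub> pres_class R u \<otimes>\<^bsub>?P\<^esub> (inv\<^bsub>?P\<^esub> pres_class R v \<otimes>\<^bsub>?P\<^esub>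
      (pres_class R u \<otimes>\<^bsub>?P\<^esub> pres_class R v))"
    by (simp only: word_commutator_def presented_group_mult pres_class_word_inv[symmetric])
  finally show ?thesis by (simp add: m_assoc[symmetric])
qed

section \<open>Coordinates modulo the centre\<close>

lemma dvd_iff_if_dvd_diff: "m dvd x - y \<Longrightarrow> m dvd x \<longleftrightarrow> m dvd y" for m :: int
  using dvd_add_right_iff[of m "x - y" y] by simp

text \<open>The shift of \<open>d\<close> by \<open>a (a - 1) / 2\<close> makes the commutation relation bilinear.\<close>

fun phi7_coords :: "nat \<Rightarrow> phi7_exps \<Rightarrow> int \<times> int \<times> int \<times> int" where
  "phi7_coords p (a, d, b, c, e) =
     (a mod int p, b mod int p, c mod int p, (d + binom2 a) mod int p)"

lemma phi7_comm_mod: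
  "phi7_comm q (a mod q, b mod q, c mod q, d mod q) (a' mod q, b' mod q, c' mod q, d' mod q) \<longleftrightarrow>
   phi7_comm q (a, b, c, d) (a', b', c', d')"
proof -
  have m: "q dvd x mod q - x" for x by (simp add: mod_eq_dvd_iff[symmetric])
  note mm = dvd_diff_mult[OF m m]
  have "q dvd a mod q * (b' mod q) - a' mod q * (b mod q) \<longleftrightarrow> q dvd a * b' - a' * b"
    using dvd_diff[OF mm[of a b'] mm[of a' b]]
    by (intro dvd_iff_if_dvd_diff) (simp add: algebra_simps)
  moreover have "q dvd a mod q * (c' mod q) - a' mod q * (c mod q) + d mod q * (b' mod q)
      - d' mod q * (b mod q) \<longleftrightarrow> q dvd a * c' - a' * c + d * b' - d' * b"
    using dvd_add[OF dvd_diff[OF mm[of a c'] mm[of a' c]] dvd_diff[OF mm[of d b'] mm[of d' b]]]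
    by (intro dvd_iff_if_dvd_diff) (simp add: algebra_simps)
  ultimately show ?thesis by simp
qed

lemma binom2_add: "binom2 (a + a') = binom2 a + binom2 a' + a * a'"
proof -
  have "2 * binom2 (a + a') = 2 * (binom2 a + binom2 a' + a * a')"
    by (simp only: two_binom2 distrib_left) (simp add: algebra_simps)
  thus ?thesis by simp
qed

text \<open>Modulo \<open>p\<close>, the coordinates of the product exceed those of \<open>t\<close>
  by \<open>a\<close>, \<open>b\<close>, \<open>c + b * a'\<close> and
  \<open>d + binom2 a + a * a'\<close>; once \<open>p\<close> divides \<open>a\<close> and
  \<open>b\<close>, the mixed terms drop out.\<close>

lemma phi7_coords_mult_eq_iff:
  "phi7_coords p (phi7_mult s t) = phi7_coords p t \<longleftrightarrow> phi7_coords p s = (0, 0, 0, 0)"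
proof -
  obtain a d b c e where s: "s = (a, d, b, c, e)" by (cases s)
  obtain a' d' b' c' e' where t: "t = (a', d', b', c', e')" by (cases t)
  let ?q = "int p"
  have red: "?q dvd x + y * z \<longleftrightarrow> ?q dvd x" if "?q dvd y" for x y z
    using that by (simp add: dvd_add_left_iff)
  have "phi7_coords p (phi7_mult s t) = phi7_coords p t \<longleftrightarrow>
      ?q dvd a \<and> ?q dvd b \<and> ?q dvd c + b * a' \<and> ?q dvd (d + binom2 a) + a * a'"
    by (simp add: s t mod_eq_dvd_iff binom2_add algebra_simps)
  also have "\<dots> \<longleftrightarrow> ?q dvd a \<and> ?q dvd b \<and> ?q dvd c \<and> ?q dvd d + binom2 a"
    by (metis red)
  finally show ?thesis by (simp add: s dvd_eq_mod_eq_0)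
qed

context
  fixes p :: nat
  assumes prime_p: "Factorial_Ring.prime p" and odd_p: "odd p"
begin

interpretation P: group "phi7_group p"
  unfolding phi7_group_def by (rule group_presented_group)

abbreviation cls :: "phi7_gen word \<Rightarrow> phi7_gen word set" where
  "cls \<equiv> pres_class (phi7_relations p)"

abbreviation coords :: "phi7_gen word \<Rightarrow> int \<times> int \<times> int \<times> int" where
  "coords w \<equiv> phi7_coords p (phi7_exponents w)"

lemmas cls_mult = presented_group_mult[of "phi7_relations p", folded phi7_group_def]
lemmas cls_closed = pres_class_closed[of "phi7_relations p", folded phi7_group_def]
lemmas cls_inv = pres_class_word_inv[of "phi7_relations p", folded phi7_group_def]
lemmas cls_pow = pres_class_word_pow[of "phi7_relations p", folded phi7_group_def]
lemmas cls_Nil = pres_class_Nil[of "phi7_relations p", folded phi7_group_def]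
lemmas cls_commutator = pres_class_commutator[of _ _ _ "phi7_relations p", folded phi7_group_def]

lemma phi7_group_generators:
  "phi7_generators (phi7_group p) p (cls (gen Al)) (cls (gen Al1)) (cls (gen Al2)) (cls (gen Al3)) (cls (gen Be))"
proof -
  have comm: "cls (gen x) \<otimes>\<^bsub>phi7_group p\<^esub> cls (gen y) =
      cls (gen y) \<otimes>\<^bsub>phi7_group p\<^esub> (cls (gen x) \<otimes>\<^bsub>phi7_group p\<^esub> cls (gen z))"
    if "(x, y, z) \<in> phi7_commutators" for x y z
    using that by (intro cls_commutator) (auto simp: phi7_relations_def)
  have triv: "cls (gen x) \<otimes>\<^bsub>phi7_group p\<^esub> cls (gen y) = cls (gen y) \<otimes>\<^bsub>phi7_group p\<^esub> cls (gen x)"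
    if "\<forall>z. (x, y, z) \<notin> phi7_commutators \<and> (y, x, z) \<notin> phi7_commutators" for x y
  proof -
    have "(word_commutator (gen x) (gen y), []) \<in> phi7_relations p"
      using that unfolding phi7_relations_def by blast
    from cls_commutator[OF this] show ?thesis by (simp add: cls_Nil cls_closed)
  qed
  have rel: "cls u = \<one>\<^bsub>phi7_group p\<^esub>" if "(u, []) \<in> phi7_relations p" for u
    unfolding cls_Nil[symmetric] pres_class_eq_iff using that by (rule pres_eq.rel)
  have pow: "cls (gen x) [^]\<^bsub>phi7_group p\<^esub> p = \<one>\<^bsub>phi7_group p\<^esub>" if "x \<in> {Al, Al2, Al3, Be}" for x
    unfolding cls_pow[symmetric] by (rule rel) (use that in \<open>auto simp: phi7_relations_def\<close>)
  have "(word_pow (gen Al1) p @ word_pow (gen Al2) (p choose 2) @ word_pow (gen Al3) (p choose 3), [])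
      \<in> phi7_relations p"
    by (simp add: phi7_relations_def)
  hence pow1: "cls (gen Al1) [^]\<^bsub>phi7_group p\<^esub> p \<otimes>\<^bsub>phi7_group p\<^esub> cls (gen Al2) [^]\<^bsub>phi7_group p\<^esub> (p choose 2)
      \<otimes>\<^bsub>phi7_group p\<^esub> cls (gen Al3) [^]\<^bsub>phi7_group p\<^esub> (p choose 3) = \<one>\<^bsub>phi7_group p\<^esub>"
    unfolding cls_pow[symmetric] cls_mult append_assoc by (rule rel)
  show ?thesis
    by unfold_locales
      (use p_dvd_choose_2[OF prime_p odd_p] pow1 in
        \<open>simp_all add: cls_closed comm triv pow phi7_commutators_def\<close>)
qed

interpretation P: phi7_generators "phi7_group p" p "cls (gen Al)" "cls (gen Al1)" "cls (gen Al2)"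
    "cls (gen Al3)" "cls (gen Be)"
  by (rule phi7_group_generators)

lemma cls_eq_normal_form: "cls w = P.normal_form (phi7_exponents w)"
proof (induction w rule: rev_induct)
  case Nil
  show ?case by (simp add: phi7_exponents_def cls_Nil)
next
  case (snoc x w)
  obtain g y where x: "x = (g, y)" by (cases x)
  have letter: "cls [(g, True)] = P.letter g" for g
    unfolding gen_def[symmetric] by (cases g) (simp_all add: P.letter_def)
  have "word_inv [(g, True)] = [(g, False)]" by (simp add: word_inv_def)
  hence letter_inv: "cls [(g, False)] = inv\<^bsub>phi7_group p\<^esub> P.letter g"
    using cls_inv[of "[(g, True)]"] letter by simp
  have "cls (w @ [x]) = cls w \<otimes>\<^bsub>phi7_group p\<^esub> cls [x]" by (simp add: cls_mult)
  also have "\<dots> = P.normal_form (phi7_step x (phi7_exponents w))"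
    by (cases y) (simp_all add: x letter letter_inv snoc.IH P.normal_form_letter P.normal_form_letter_inv)
  finally show ?case by (simp add: phi7_exponents_def)
qed

text \<open>Solves the word problem: invariance of exponents under the relations gives one
  direction, equality of normal forms the other.\<close>

lemma cls_eq_iff: "cls u = cls v \<longleftrightarrow> phi7_cong p (phi7_exponents u) (phi7_exponents v)"
proof
  assume "cls u = cls v"
  thus "phi7_cong p (phi7_exponents u) (phi7_exponents v)"
    unfolding pres_class_eq_iff by (rule phi7_cong_if_pres_eq[OF prime_p odd_p])
next
  assume cong: "phi7_cong p (phi7_exponents u) (phi7_exponents v)"
  have "cls u = P.normal_form (phi7_exponents u)" by (rule cls_eq_normal_form)
  also have "\<dots> = P.normal_form (phi7_exponents v)" by (rule P.normal_form_cong[OF cong])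
  also have "\<dots> = cls v" by (rule cls_eq_normal_form[symmetric])
  finally show "cls u = cls v" .
qed

lemma cls_commute_iff:
  "cls u \<otimes>\<^bsub>phi7_group p\<^esub> cls v = cls v \<otimes>\<^bsub>phi7_group p\<^esub> cls u \<longleftrightarrow>
    phi7_comm (int p) (coords u) (coords v)"
proof -
  obtain a d b c e where u: "phi7_exponents u = (a, d, b, c, e)" by (cases "phi7_exponents u")
  obtain a' d' b' c' e' where v: "phi7_exponents v = (a', d', b', c', e')" by (cases "phi7_exponents v")
  \<comment> \<open>The two products have equal exponents of \<open>\<alpha>\<^sub>1\<close>, so
    \<open>p \<noteq> 0\<close> forces the carry in \<open>phi7_cong\<close> to be 0.\<close>
  have p0: "p \<noteq> 0" using prime_p by auto
  have "cls u \<otimes>\<^bsub>phi7_group p\<^esub> cls v = cls v \<otimes>\<^bsub>phi7_group p\<^esub> cls u \<longleftrightarrow>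
      int p dvd b * a' - b' * a \<and>
      int p dvd c * a' + b * (binom2 a' + d') - (c' * a + b' * (binom2 a + d))"
    using p0 by (simp add: cls_mult cls_eq_iff phi7_exponents_append u v algebra_simps)
  also have "\<dots> \<longleftrightarrow> int p dvd - (b * a' - b' * a) \<and>
      int p dvd - (c * a' + b * (binom2 a' + d') - (c' * a + b' * (binom2 a + d)))"
    by (simp only: dvd_minus_iff)
  \<comment> \<open>The terms \<open>binom2 a\<close> and \<open>binom2 a'\<close> are absorbed into
    the shifted fourth coordinates.\<close>
  also have "\<dots> \<longleftrightarrow> phi7_comm (int p) (a, b, c, d + binom2 a) (a', b', c', d' + binom2 a')"
    by (simp add: algebra_simps)
  finally show ?thesis unfolding u v phi7_coords.simps phi7_comm_mod .
qed

lemma coords_in_space: "coords w \<in> phi7_space (int p)"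
  using prime_gt_0_nat[OF prime_p] by (cases "phi7_exponents w") (simp add: phi7_space_def)

lemma coords_surj:
  assumes "v \<in> phi7_space (int p)"
  obtains w where "coords w = v"
proof -
  obtain a b c d where v: "v = (a, b, c, d)" by (cases v)
  \<comment> \<open>The exponent of \<beta> undoes the shift by \<open>binom2 a\<close> and is
    reduced modulo \<open>p\<close> to be nonnegative; the letters come in normal order, so no
    correction terms arise.\<close>
  define w where "w = word_pow (gen Al) (nat a) @ word_pow (gen Be) (nat ((d - binom2 a) mod int p)) @
    word_pow (gen Al1) (nat b) @ word_pow (gen Al2) (nat c)"
  have "phi7_exponents w = (a, (d - binom2 a) mod int p, b, c, 0)"
    using assms prime_gt_0_nat[OF prime_p]
    by (simp add: w_def phi7_exponents_append phi7_exponents_pow v phi7_space_def)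
  hence "coords w = v" using assms by (simp add: v phi7_space_def mod_simps)
  thus thesis by (rule that)
qed

lemma cls_surj: "x \<in> carrier (phi7_group p) \<Longrightarrow> \<exists>w. x = cls w"
  by (auto simp: phi7_group_def presented_group_def)

lemma cls_central_iff: "cls w \<in> group_center (phi7_group p) \<longleftrightarrow> coords w = (0, 0, 0, 0)"
proof -
  have "cls w \<in> group_center (phi7_group p) \<longleftrightarrow> (\<forall>v. phi7_comm (int p) (coords w) (coords v))"
    unfolding group_center_def cls_commute_iff[symmetric] using cls_surj cls_closed by blast
  also have "\<dots> \<longleftrightarrow> coords w = (0, 0, 0, 0)"
  proof
    assume comm: "\<forall>v. phi7_comm (int p) (coords w) (coords v)"
    obtain a b c d where w: "coords w = (a, b, c, d)" by (cases "coords w")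
    have "1 < p" by (rule prime_gt_1_nat[OF prime_p])
    \<comment> \<open>Commuting with the first point isolates \<open>b\<close> and \<open>c\<close>,
      commuting with the second isolates \<open>a\<close> and \<open>d\<close>.\<close>
    hence "(1, 0, 0, 0) \<in> phi7_space (int p)" "(0, 1, 0, 0) \<in> phi7_space (int p)"
      by (simp_all add: phi7_space_def)
    hence "phi7_comm (int p) (a, b, c, d) (1, 0, 0, 0)" "phi7_comm (int p) (a, b, c, d) (0, 1, 0, 0)"
      using comm coords_surj w by metis+
    hence "int p dvd a \<and> int p dvd b \<and> int p dvd c \<and> int p dvd d" by simp
    thus "coords w = (0, 0, 0, 0)"
      using coords_in_space[of w] unfolding w phi7_space_def
      by (simp add: residue_zero_iff del: atLeastLessThan_iff)
  next
    assume w: "coords w = (0, 0, 0, 0)"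
    have "phi7_comm (int p) (0, 0, 0, 0) x" for x by (cases x) simp
    thus "\<forall>v. phi7_comm (int p) (coords w) (coords v)" by (simp only: w) simp
  qed
  finally show ?thesis .
qed

text \<open>Coordinates depend only on the class of a word, and \<open>u\<close> has the class of
  \<open>(u v^-1) v\<close>; the rule for coordinates of a product then compares \<open>u\<close>
  with \<open>v\<close>.\<close>

lemma coords_eq_iff:
  "coords u = coords v \<longleftrightarrow>
    cls u \<otimes>\<^bsub>phi7_group p\<^esub> inv\<^bsub>phi7_group p\<^esub> cls v \<in> group_center (phi7_group p)"
proof -
  let ?w = "u @ word_inv v"
  have "cls u = cls (?w @ v)"
    by (simp add: cls_mult[symmetric] cls_inv cls_closed P.m_assoc)
  hence cong: "phi7_cong p (phi7_exponents u) (phi7_exponents (?w @ v))"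
    by (simp only: cls_eq_iff)
  have "coords u = coords (?w @ v)"
  proof -
    obtain a d b c e where s: "phi7_exponents u = (a, d, b, c, e)" by (cases "phi7_exponents u")
    obtain a' d' b' c' e' where t: "phi7_exponents (?w @ v) = (a', d', b', c', e')"
      by (cases "phi7_exponents (?w @ v)")
    have h: "int p dvd a - a'" "int p dvd d - d'" "int p dvd b - b'" "int p dvd c - c'"
      using cong unfolding s t by auto
    hence "int p dvd (d + binom2 a) - (d' + binom2 a')"
      using dvd_add[OF h(2) binom2_cong[OF prime_p odd_p h(1)]] by (simp add: algebra_simps)
    thus ?thesis using h unfolding s t by (simp add: mod_eq_dvd_iff)
  qed
  hence "coords u = coords v \<longleftrightarrow> coords ?w = (0, 0, 0, 0)"
    by (simp only: phi7_exponents_append[of ?w v] phi7_coords_mult_eq_iff)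
  thus ?thesis by (simp only: cls_central_iff[symmetric] cls_mult[symmetric] cls_inv)
qed

end

subsection \<open>Transfer along isoclinism\<close>

lemma (in group) subgroup_group_center: "subgroup (group_center G) G"
proof (rule subgroupI)
  show "group_center G \<noteq> {}" by (auto simp: group_center_def)
next
  fix z assume z: "z \<in> group_center G"
  hence zc: "z \<in> carrier G" by (simp add: group_center_def)
  have "inv z \<otimes> g = g \<otimes> inv z" if g: "g \<in> carrier G" for g
  proof -
    have "inv z \<otimes> g = inv z \<otimes> (g \<otimes> z) \<otimes> inv z" using zc g by (simp add: m_assoc)
    also have "g \<otimes> z = z \<otimes> g" using z g by (simp add: group_center_def)
    also have "inv z \<otimes> (z \<otimes> g) = g" using zc g by (simp add: m_assoc[symmetric])
    finally show ?thesis .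
  qed
  thus "inv z \<in> group_center G" using zc by (simp add: group_center_def)
next
  fix y z assume yz: "y \<in> group_center G" "z \<in> group_center G"
  hence c: "y \<in> carrier G" "z \<in> carrier G" by (simp_all add: group_center_def)
  have "y \<otimes> z \<otimes> g = g \<otimes> (y \<otimes> z)" if g: "g \<in> carrier G" for g
  proof -
    have "y \<otimes> z \<otimes> g = y \<otimes> (z \<otimes> g)" using c g by (simp add: m_assoc)
    also have "z \<otimes> g = g \<otimes> z" using yz g by (simp add: group_center_def)
    also have "y \<otimes> (g \<otimes> z) = y \<otimes> g \<otimes> z" using c g by (simp add: m_assoc)
    also have "y \<otimes> g = g \<otimes> y" using yz g by (simp add: group_center_def)
    finally show ?thesis using c g by (simp add: m_assoc)
  qed
  thus "y \<otimes> z \<in> group_center G" using c by (simp add: group_center_def)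
qed (auto simp: group_center_def)

lemma (in group) rcos_eq_iff:
  assumes H: "subgroup H G" and x: "x \<in> carrier G" and y: "y \<in> carrier G"
  shows "H #> x = H #> y \<longleftrightarrow> x \<otimes> inv y \<in> H"
proof
  assume "H #> x = H #> y"
  hence "x \<in> H #> y" using rcos_self[OF x H] by simp
  then obtain h where h: "h \<in> H" "x = h \<otimes> y" by (auto simp: r_coset_def)
  thus "x \<otimes> inv y \<in> H" using y subgroup.mem_carrier[OF H] by (simp add: m_assoc)
next
  assume h: "x \<otimes> inv y \<in> H"
  have "x = (x \<otimes> inv y) \<otimes> y" using x y by (simp add: m_assoc)
  hence "x \<in> H #> y" using h unfolding r_coset_def by blast
  from repr_independence[OF this y H] show "H #> x = H #> y" by (rule HOL.sym)
qed

lemma (in group) commute_iff_commutator: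
  assumes "x \<in> carrier G" "y \<in> carrier G"
  shows "x \<otimes> y = y \<otimes> x \<longleftrightarrow> group_commutator G x y = \<one>"
proof -
  have "group_commutator G x y = inv (y \<otimes> x) \<otimes> (x \<otimes> y)"
    using assms by (simp add: group_commutator_def inv_mult_group m_assoc)
  moreover have "inv (y \<otimes> x) \<otimes> (x \<otimes> y) = \<one> \<longleftrightarrow> x \<otimes> y = y \<otimes> x"
  proof
    assume "inv (y \<otimes> x) \<otimes> (x \<otimes> y) = \<one>"
    thus "x \<otimes> y = y \<otimes> x"
      using l_cancel[of "inv (y \<otimes> x)" "x \<otimes> y" "y \<otimes> x"] assms by simp
  next
    assume eq: "x \<otimes> y = y \<otimes> x"
    show "inv (y \<otimes> x) \<otimes> (x \<otimes> y) = \<one>"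
      unfolding eq using assms by simp
  qed
  ultimately show ?thesis by simp
qed

lemma (in group) group_commutator_in_derived:
  assumes "x \<in> carrier G" "y \<in> carrier G"
  shows "group_commutator G x y \<in> derived G (carrier G)"
proof -
  \<comment> \<open>The elements of \<open>derived_set\<close> have the form
    \<open>x y x^-1 y^-1\<close>, so \<open>x\<close> and \<open>y\<close> enter inverted.\<close>
  have "group_commutator G x y \<in> {inv x \<otimes> inv y \<otimes> inv (inv x) \<otimes> inv (inv y)}"
    using assms by (simp add: group_commutator_def)
  hence "group_commutator G x y \<in> derived_set G (carrier G)"
    by (rule UN_I[OF inv_closed[OF assms(1)], OF UN_I[OF inv_closed[OF assms(2)]]])
  thus ?thesis unfolding derived_def by (rule generate.incl)
qed

lemma (in group) group_derived_group: "group (derived_group G)"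
  unfolding derived_group_def by (rule subgroup_imp_group[OF derived_is_subgroup]) simp

text \<open>\<phi> is injective and maps identity to identity, so it preserves and reflects
  triviality of commutators.\<close>

lemma isoclinic_commute_iff:
  assumes G: "group G" and H: "group H"
    and phi: "\<phi> \<in> iso (derived_group G) (derived_group H)"
    and x: "x1 \<in> carrier G" "x2 \<in> carrier G" and y: "y1 \<in> carrier H" "y2 \<in> carrier H"
    and comm: "\<phi> (group_commutator G x1 x2) = group_commutator H y1 y2"
  shows "x1 \<otimes>\<^bsub>G\<^esub> x2 = x2 \<otimes>\<^bsub>G\<^esub> x1 \<longleftrightarrow> y1 \<otimes>\<^bsub>H\<^esub> y2 = y2 \<otimes>\<^bsub>H\<^esub> y1"
proof -
  interpret G: group G by (rule G)
  interpret H: group H by (rule H)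
  have "\<phi> \<in> hom (derived_group G) (derived_group H)" using phi by (simp add: iso_def)
  from hom_one[OF this G.group_derived_group H.group_derived_group]
  have one: "\<phi> \<one>\<^bsub>G\<^esub> = \<one>\<^bsub>H\<^esub>" by (simp add: derived_group_def)
  have inj: "inj_on \<phi> (derived G (carrier G))"
    using phi by (simp add: iso_def bij_betw_def derived_group_def)
  have mem: "\<one>\<^bsub>G\<^esub> \<in> derived G (carrier G)"
    by (rule subgroup.one_closed[OF G.derived_is_subgroup]) simp
  have "group_commutator G x1 x2 = \<one>\<^bsub>G\<^esub> \<longleftrightarrow> group_commutator H y1 y2 = \<one>\<^bsub>H\<^esub>"
    using inj_on_eq_iff[OF inj G.group_commutator_in_derived[OF x] mem] by (simp add: comm one)
  thus ?thesis by (simp add: G.commute_iff_commutator x H.commute_iff_commutator y)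
qed

text \<open>\<open>F x\<close> is the coordinate vector of a word representing the \<theta>-image of
  the central coset of \<open>x\<close>. Coordinates separate the cosets in the presented group and
  \<theta> is bijective, so the fibres of \<open>F\<close> are the cosets of the centre of
  \<open>G\<close>.\<close>

lemma isoclinic_phi7_coordinates:
  assumes p: "Factorial_Ring.prime p" "odd p" and G: "group G" and fin: "finite (carrier G)"
    and iso: "isoclinic G (phi7_group p)"
  obtains F where "F ` carrier G \<subseteq> phi7_space (int p)"
    and "\<And>v. v \<in> phi7_space (int p) \<Longrightarrow> card {x \<in> carrier G. F x = v} = card (group_center G)"
    and "\<And>x y. x \<in> carrier G \<Longrightarrow> y \<in> carrier G \<Longrightarrow>
      x \<otimes>\<^bsub>G\<^esub> y = y \<otimes>\<^bsub>G\<^esub> x \<longleftrightarrow> phi7_comm (int p) (F x) (F y)"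
proof -
  let ?P = "phi7_group p" and ?cls = "pres_class (phi7_relations p)"
  let ?ZG = "group_center G" and ?ZP = "group_center (phi7_group p)"
  let ?coords = "\<lambda>w. phi7_coords p (phi7_exponents w)"
  interpret G: group G by (rule G)
  interpret P: group ?P unfolding phi7_group_def by (rule group_presented_group)
  have cls_closed: "?cls w \<in> carrier ?P" for w
    unfolding phi7_group_def by (rule pres_class_closed)
  obtain \<theta> \<phi> where theta: "\<theta> \<in> iso (G Mod ?ZG) (?P Mod ?ZP)"
    and phi: "\<phi> \<in> iso (derived_group G) (derived_group ?P)"
    and comm: "\<And>g1 g2 h1 h2. g1 \<in> carrier G \<Longrightarrow> g2 \<in> carrier G \<Longrightarrow> h1 \<in> carrier ?P \<Longrightarrow> h2 \<in> carrier ?P \<Longrightarrow>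
      \<theta> (?ZG #>\<^bsub>G\<^esub> g1) = ?ZP #>\<^bsub>?P\<^esub> h1 \<Longrightarrow> \<theta> (?ZG #>\<^bsub>G\<^esub> g2) = ?ZP #>\<^bsub>?P\<^esub> h2 \<Longrightarrow>
      \<phi> (group_commutator G g1 g2) = group_commutator ?P h1 h2"
    using iso unfolding isoclinic_def by blast
  have bij: "bij_betw \<theta> (rcosets\<^bsub>G\<^esub> ?ZG) (rcosets\<^bsub>?P\<^esub> ?ZP)"
    using theta by (simp add: iso_def FactGroup_def)
  have ZG: "subgroup ?ZG G" and ZP: "subgroup ?ZP ?P"
    by (rule G.subgroup_group_center P.subgroup_group_center)+
  have cosG: "?ZG #>\<^bsub>G\<^esub> x \<in> rcosets\<^bsub>G\<^esub> ?ZG" if "x \<in> carrier G" for x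
    using that by (intro G.rcosetsI subgroup.subset[OF ZG])
  have "\<exists>w. \<theta> (?ZG #>\<^bsub>G\<^esub> x) = ?ZP #>\<^bsub>?P\<^esub> ?cls w" if x: "x \<in> carrier G" for x
  proof -
    have "\<theta> (?ZG #>\<^bsub>G\<^esub> x) \<in> rcosets\<^bsub>?P\<^esub> ?ZP" using bij cosG[OF x] by (rule bij_betwE[rule_format])
    then obtain h where h: "h \<in> carrier ?P" "\<theta> (?ZG #>\<^bsub>G\<^esub> x) = ?ZP #>\<^bsub>?P\<^esub> h"
      by (auto simp: RCOSETS_def)
    obtain w where "h = ?cls w" using cls_surj[OF p h(1)] by blast
    thus ?thesis using h(2) by blast
  qed
  hence "\<forall>x \<in> carrier G. \<exists>w. \<theta> (?ZG #>\<^bsub>G\<^esub> x) = ?ZP #>\<^bsub>?P\<^esub> ?cls w" by blast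
  from bchoice[OF this] obtain W where
    W: "\<And>x. x \<in> carrier G \<Longrightarrow> \<theta> (?ZG #>\<^bsub>G\<^esub> x) = ?ZP #>\<^bsub>?P\<^esub> ?cls (W x)"
    by blast
  have coords_iff: "?coords u = ?coords v \<longleftrightarrow> ?ZP #>\<^bsub>?P\<^esub> ?cls u = ?ZP #>\<^bsub>?P\<^esub> ?cls v" for u v
    by (simp only: coords_eq_iff[OF p] P.rcos_eq_iff[OF ZP cls_closed cls_closed])
  show thesis
  proof
    show "(\<lambda>x. ?coords (W x)) ` carrier G \<subseteq> phi7_space (int p)"
      using coords_in_space[OF p] by blast
  next
    fix v assume "v \<in> phi7_space (int p)"
    then obtain w where w: "?coords w = v" by (rule coords_surj[OF p])
    have "?ZP #>\<^bsub>?P\<^esub> ?cls w \<in> rcosets\<^bsub>?P\<^esub> ?ZP"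
      by (intro P.rcosetsI subgroup.subset[OF ZP] cls_closed)
    hence "?ZP #>\<^bsub>?P\<^esub> ?cls w \<in> \<theta> ` (rcosets\<^bsub>G\<^esub> ?ZG)"
      using bij by (simp add: bij_betw_def)
    then obtain g where g: "g \<in> carrier G" "\<theta> (?ZG #>\<^bsub>G\<^esub> g) = ?ZP #>\<^bsub>?P\<^esub> ?cls w"
      by (auto simp: RCOSETS_def)
    have "?coords (W x) = v \<longleftrightarrow> x \<in> ?ZG #>\<^bsub>G\<^esub> g" if x: "x \<in> carrier G" for x
    proof -
      have "?coords (W x) = v \<longleftrightarrow> \<theta> (?ZG #>\<^bsub>G\<^esub> x) = \<theta> (?ZG #>\<^bsub>G\<^esub> g)"
        by (simp only: w[symmetric] coords_iff W[OF x] g)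
      also have "\<dots> \<longleftrightarrow> ?ZG #>\<^bsub>G\<^esub> x = ?ZG #>\<^bsub>G\<^esub> g"
        by (rule inj_on_eq_iff[OF bij_betw_imp_inj_on[OF bij] cosG[OF x] cosG[OF g(1)]])
      also have "\<dots> \<longleftrightarrow> x \<in> ?ZG #>\<^bsub>G\<^esub> g"
      proof
        assume "?ZG #>\<^bsub>G\<^esub> x = ?ZG #>\<^bsub>G\<^esub> g"
        thus "x \<in> ?ZG #>\<^bsub>G\<^esub> g" using G.rcos_self[OF x ZG] by simp
      next
        assume "x \<in> ?ZG #>\<^bsub>G\<^esub> g"
        from G.repr_independence[OF this g(1) ZG]
        show "?ZG #>\<^bsub>G\<^esub> x = ?ZG #>\<^bsub>G\<^esub> g" by (rule HOL.sym)
      qed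
      finally show ?thesis .
    qed
    hence "{x \<in> carrier G. ?coords (W x) = v} = ?ZG #>\<^bsub>G\<^esub> g"
      using G.r_coset_subset_G[OF subgroup.subset[OF ZG] g(1)] by blast
    thus "card {x \<in> carrier G. ?coords (W x) = v} = card ?ZG"
      using G.card_rcosets_equal[OF cosG[OF g(1)] subgroup.subset[OF ZG]] by simp
  next
    fix x y assume xy: "x \<in> carrier G" "y \<in> carrier G"
    show "x \<otimes>\<^bsub>G\<^esub> y = y \<otimes>\<^bsub>G\<^esub> x \<longleftrightarrow> phi7_comm (int p) (?coords (W x)) (?coords (W y))"
      unfolding cls_commute_iff[OF p, symmetric]
      by (rule isoclinic_commute_iff[OF G P.group_axioms phi xy cls_closed cls_closed])
        (rule comm[OF xy cls_closed cls_closed W[OF xy(1)] W[OF xy(2)]])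
  qed
qed

subsection \<open>Orbit counts\<close>

lemma (in group) invariants_sim_conj:
  assumes g: "g \<in> carrier G" and E: "\<And>xs. xs \<in> E \<Longrightarrow> set xs \<subseteq> carrier G"
  shows "invariants E (sim_conj G E) g = {xs \<in> E. \<forall>x \<in> set xs. g \<otimes> x = x \<otimes> g}"
proof -
  have "map (\<lambda>x. g \<otimes> x \<otimes> inv g) xs = xs \<longleftrightarrow> (\<forall>x \<in> set xs. g \<otimes> x = x \<otimes> g)" if "xs \<in> E" for xs
  proof -
    have "g \<otimes> x \<otimes> inv g = x \<longleftrightarrow> g \<otimes> x = x \<otimes> g" if "x \<in> set xs" for x
    proof -
      have x: "x \<in> carrier G" using E[OF \<open>xs \<in> E\<close>] that by blast
      show ?thesis
      proof
        assume "g \<otimes> x \<otimes> inv g = x"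
        hence "g \<otimes> x \<otimes> inv g \<otimes> g = x \<otimes> g" by simp
        thus "g \<otimes> x = x \<otimes> g" using g x by (simp add: m_assoc)
      next
        assume "g \<otimes> x = x \<otimes> g"
        thus "g \<otimes> x \<otimes> inv g = x" using g x by (simp add: m_assoc)
      qed
    qed
    thus ?thesis using map_eq_conv[of _ xs "\<lambda>x. x"] by simp
  qed
  thus ?thesis by (auto simp: invariants_def sim_conj_def)
qed

text \<open>The \<open>n\<close>-tuples fixed by \<open>g\<close> are those with all entries in the
  centralizer of \<open>g\<close>.\<close>

lemma (in group) tuple_orbits_burnside:
  assumes fin: "finite (carrier G)"
  shows "tuple_orbits G n * Coset.order G =
    (\<Sum>g\<in>carrier G. card {x \<in> carrier G. g \<otimes> x = x \<otimes> g} ^ n)"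
proof -
  interpret group_action G "group_tuples G n" "sim_conj G (group_tuples G n)"
    by (rule sim_conj_action_tuples)
  have eq: "group_tuples G n = {xs. set xs \<subseteq> carrier G \<and> length xs = n}"
    by (auto simp: group_tuples_def)
  have "invariants (group_tuples G n) (sim_conj G (group_tuples G n)) g =
      {xs. set xs \<subseteq> {x \<in> carrier G. g \<otimes> x = x \<otimes> g} \<and> length xs = n}" if "g \<in> carrier G" for g
    using that by (subst invariants_sim_conj) (auto simp: group_tuples_def)
  hence "card (invariants (group_tuples G n) (sim_conj G (group_tuples G n)) g) =
      card {x \<in> carrier G. g \<otimes> x = x \<otimes> g} ^ n" if "g \<in> carrier G" for g
    using that fin by (simp add: card_lists_length_eq)
  thus ?thesis
    using burnside[OF fin] finite_lists_length_eq[OF fin, of n] by (simp add: tuple_orbits_def eq)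
qed

lemma (in group) commuting_tuples_eq_pairwise_tuples:
  "commuting_tuples G n = pairwise_tuples (\<lambda>x y. x \<otimes> y = y \<otimes> x) (carrier G) n"
  by (auto simp: commuting_tuples_def group_tuples_def pairwise_tuples_def)

text \<open>A commuting \<open>n\<close>-tuple fixed by \<open>g\<close> becomes, with
  \<open>g\<close> put in front, a commuting \<open>(n + 1)\<close>-tuple; hence the index
  \<open>Suc n\<close>.\<close>

lemma (in group) commuting_orbits_burnside:
  assumes fin: "finite (carrier G)"
  shows "commuting_orbits G n * Coset.order G = card (commuting_tuples G (Suc n))"
proof -
  let ?R = "\<lambda>x y. x \<otimes> y = y \<otimes> x"
  interpret group_action G "commuting_tuples G n" "sim_conj G (commuting_tuples G n)"
    by (rule sim_conj_action_commuting)
  have "finite (commuting_tuples G n)"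
    by (simp add: commuting_tuples_eq_pairwise_tuples finite_pairwise_tuples fin)
  from burnside[OF fin this]
  have "commuting_orbits G n * Coset.order G =
      (\<Sum>g\<in>carrier G. card (invariants (commuting_tuples G n) (sim_conj G (commuting_tuples G n)) g))"
    by (simp add: commuting_orbits_def)
  also have "\<dots> = (\<Sum>g\<in>carrier G. card (pairwise_tuples ?R {x \<in> carrier G. g \<otimes> x = x \<otimes> g} n))"
  proof (rule sum.cong[OF HOL.refl])
    fix g assume g: "g \<in> carrier G"
    have "invariants (commuting_tuples G n) (sim_conj G (commuting_tuples G n)) g =
        {xs \<in> commuting_tuples G n. \<forall>x \<in> set xs. g \<otimes> x = x \<otimes> g}"
      by (rule invariants_sim_conj[OF g]) (auto simp: commuting_tuples_def group_tuples_def)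
    also have "\<dots> = pairwise_tuples ?R {x \<in> carrier G. g \<otimes> x = x \<otimes> g} n"
      by (auto simp: commuting_tuples_eq_pairwise_tuples pairwise_tuples_def)
    finally show "card (invariants (commuting_tuples G n) (sim_conj G (commuting_tuples G n)) g) =
        card (pairwise_tuples ?R {x \<in> carrier G. g \<otimes> x = x \<otimes> g} n)" by simp
  qed
  also have "\<dots> = card (pairwise_tuples ?R (carrier G) (Suc n))"
    by (rule card_pairwise_tuples_Suc[OF fin, symmetric]) auto
  finally show ?thesis by (simp only: commuting_tuples_eq_pairwise_tuples)
qed

section \<open>Coefficients of the generating functions\<close>

lemma fps_nth_geometric:
  "fps_nth (fps_const k / (1 - fps_const a * fps_X)) n = k * a ^ n" for a k :: real
proof -
  have "fps_const k / (1 - fps_const a * fps_X) =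
      fps_const k * (Abs_fps (\<lambda>n. 1) oo (fps_const a * fps_X))"
    by (subst gp) (simp_all add: fps_divide_unit)
  thus ?thesis by simp
qed

text \<open>\<open>G\<close> enters only through the order \<open>z\<close> of its centre: its order
  is \<open>z * p ^ 4\<close> and each centralizer has \<open>z\<close> times the order found in
  coordinates, so the normalisation removes \<open>z\<close>.\<close>

lemma phi7_orbit_counts:
  assumes p: "Factorial_Ring.prime p" "odd p" and G: "group G" and fin: "finite (carrier G)"
    and iso: "isoclinic G (phi7_group p)"
  shows "real (tuple_orbits G n) / real (Coset.order G) ^ n =
      (1 - real p powi (-2)) * (real p powi (-2)) ^ n
      + (real p powi (-2) - real p powi (-4)) * (real p powi (-1)) ^ n + real p powi (-4)"
    and "real (commuting_orbits G n) / real (Coset.order G) ^ n =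
      (- (real p powi (-1)) - real p powi (-2)) * (real p powi (-3)) ^ n
      + (1 + real p powi (-1) + real p powi (-2)) * (real p powi (-2)) ^ n"
proof -
  interpret G: group G by (rule G)
  let ?V = "phi7_space (int p)" and ?R = "phi7_comm (int p)"
  define z where "z = card (group_center G)"
  obtain F where F: "F ` carrier G \<subseteq> ?V"
    and fibre: "\<And>v. v \<in> ?V \<Longrightarrow> card {x \<in> carrier G. F x = v} = z"
    and comm: "\<And>x y. x \<in> carrier G \<Longrightarrow> y \<in> carrier G \<Longrightarrow> x \<otimes>\<^bsub>G\<^esub> y = y \<otimes>\<^bsub>G\<^esub> x \<longleftrightarrow> ?R (F x) (F y)"
    unfolding z_def by (rule isoclinic_phi7_coordinates[OF p G fin iso]) blast
  have pz: "Factorial_Ring.prime (int p)" using p by simp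
  have finV: "finite ?V" by simp
  have p0: "real p > 0" using prime_gt_0_nat[OF p(1)] by simp
  have order: "Coset.order G = z * p ^ 4"
    using sum_over_fibres[OF fin finV F fibre, of "\<lambda>_. 1"] card_phi7_space[OF pz]
    by (simp add: Coset.order_def)
  \<comment> \<open>With \<open>u\<close> and \<open>w\<close> standing for the \<open>n\<close>-th
    powers, the final identities become rational identities in \<open>q\<close>, \<open>u\<close>
    and \<open>w\<close>.\<close>
  define q u w where "q = real p" and "u = q ^ n" and "w = real z ^ n"
  have "Coset.order G > 0" using fin by (simp add: G.order_gt_0_iff_finite)
  hence z0: "real z > 0" using order by (cases "z = 0") simp_all
  have q0: "q > 0" "u > 0" "w > 0" using p0 z0 by (simp_all add: q_def u_def w_def)
  have pow: "(real p ^ k) ^ n = u ^ k" for k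
    by (simp add: u_def q_def power_mult[symmetric] mult.commute)
  have order_pow: "real (Coset.order G) ^ n = w * u ^ 4"
    by (simp add: order w_def power_mult_distrib pow)
  have powi: "real p powi (-1) = 1 / q" "real p powi (-2) = 1 / q ^ 2"
    "real p powi (-3) = 1 / q ^ 3" "real p powi (-4) = 1 / q ^ 4"
    by (simp_all add: power_int_def q_def field_simps)
  have powi_pow: "(1 / q) ^ n = 1 / u" "(1 / q ^ k) ^ n = 1 / u ^ k" for k
    using pow[of k] by (simp_all add: power_one_over u_def q_def)
  have cent: "card {y \<in> carrier G. x \<otimes>\<^bsub>G\<^esub> y = y \<otimes>\<^bsub>G\<^esub> x} = z * card {w \<in> ?V. ?R (F x) w}"
    if x: "x \<in> carrier G" for x
  proof -
    have "(\<Sum>y\<in>carrier G. if ?R (F x) (F y) then 1 else 0) =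
        z * (\<Sum>w\<in>?V. if ?R (F x) w then 1 else (0 :: nat))"
      by (rule sum_over_fibres[OF fin finV F fibre])
    thus ?thesis using fin finV comm[OF x] by (simp add: sum.If_cases Int_def cong: conj_cong)
  qed
  have "tuple_orbits G n * Coset.order G = (\<Sum>x\<in>carrier G. (z * card {w \<in> ?V. ?R (F x) w}) ^ n)"
    unfolding G.tuple_orbits_burnside[OF fin] by (rule sum.cong) (simp_all only: cent)
  also have "\<dots> = z * (\<Sum>v\<in>?V. (z * card {w \<in> ?V. ?R v w}) ^ n)"
    by (rule sum_over_fibres[OF fin finV F fibre])
  finally have "real (tuple_orbits G n * Coset.order G) =
      real (z * (\<Sum>v\<in>?V. (z * card {w \<in> ?V. ?R v w}) ^ n))"
    by (rule arg_cong)
  hence "real (tuple_orbits G n) * real (Coset.order G) =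
      real z * (real z ^ n * (\<Sum>v\<in>?V. real (card {w \<in> ?V. ?R v w}) ^ n))"
    by (simp add: power_mult_distrib sum_distrib_left)
  also have "(\<Sum>v\<in>?V. real (card {w \<in> ?V. ?R v w}) ^ n) =
      (real p ^ 4) ^ n + (real p ^ 2 - 1) * (real p ^ 3) ^ n + (real p ^ 4 - real p ^ 2) * (real p ^ 2) ^ n"
    using phi7_centralizer_power_sum[OF pz, of n] by simp
  finally have "real z * (real (tuple_orbits G n) * q ^ 4) =
      real z * (w * (u ^ 4 + (q ^ 2 - 1) * u ^ 3 + (q ^ 4 - q ^ 2) * u ^ 2))"
    unfolding pow by (simp only: order q_def w_def of_nat_mult of_nat_power mult_ac)
  hence "real (tuple_orbits G n) * q ^ 4 =
      w * (u ^ 4 + (q ^ 2 - 1) * u ^ 3 + (q ^ 4 - q ^ 2) * u ^ 2)"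
    by (simp only: mult_left_cancel[OF less_imp_neq[symmetric, OF z0]])
  hence t: "real (tuple_orbits G n) =
      w * (u ^ 4 + (q ^ 2 - 1) * u ^ 3 + (q ^ 4 - q ^ 2) * u ^ 2) / q ^ 4"
    using q0 by (simp add: eq_divide_eq)
  show "real (tuple_orbits G n) / real (Coset.order G) ^ n =
      (1 - real p powi (-2)) * (real p powi (-2)) ^ n
      + (real p powi (-2) - real p powi (-4)) * (real p powi (-1)) ^ n + real p powi (-4)"
    unfolding t order_pow powi powi_pow using q0
    by (simp add: field_simps eval_nat_numeral)
  \<comment> \<open>One of the \<open>Suc n\<close> factors \<open>z\<close> cancels against the
    factor in the group order; the other \<open>n\<close> go with the normalisation.\<close>
  have "commuting_orbits G n * Coset.order G = z ^ Suc n * card (pairwise_tuples ?R ?V (Suc n))"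
    unfolding G.commuting_orbits_burnside[OF fin] G.commuting_tuples_eq_pairwise_tuples
    by (rule card_pairwise_tuples_fibres[OF fin finV F fibre])
      (simp_all add: comm phi7_comm_refl phi7_comm_sym)
  hence "real (commuting_orbits G n * Coset.order G) =
      real (z ^ Suc n * card (pairwise_tuples ?R ?V (Suc n)))"
    by (rule arg_cong)
  hence "real (commuting_orbits G n) * real (Coset.order G) = real z ^ Suc n *
      ((1 + real p + real p ^ 2) * (real p ^ 2) ^ Suc n - (real p ^ 2 + real p) * real p ^ Suc n)"
    using card_tuples_phi7[OF pz, of "Suc n"] by (simp del: power_Suc)
  hence "real z * (real (commuting_orbits G n) * q ^ 4) =
      real z * (w * ((1 + q + q ^ 2) * (q ^ 2 * u ^ 2) - (q ^ 2 + q) * (q * u)))"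
    unfolding power_Suc pow
    by (simp only: order q_def w_def u_def of_nat_mult of_nat_power mult_ac)
  hence "real (commuting_orbits G n) * q ^ 4 =
      w * ((1 + q + q ^ 2) * (q ^ 2 * u ^ 2) - (q ^ 2 + q) * (q * u))"
    by (simp only: mult_left_cancel[OF less_imp_neq[symmetric, OF z0]])
  hence c: "real (commuting_orbits G n) =
      w * ((1 + q + q ^ 2) * (q ^ 2 * u ^ 2) - (q ^ 2 + q) * (q * u)) / q ^ 4"
    using q0 by (simp add: eq_divide_eq)
  show "real (commuting_orbits G n) / real (Coset.order G) ^ n =
      (- (real p powi (-1)) - real p powi (-2)) * (real p powi (-3)) ^ n
      + (1 + real p powi (-1) + real p powi (-2)) * (real p powi (-2)) ^ n"
    unfolding c order_pow powi powi_pow using q0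
    by (simp add: field_simps eval_nat_numeral)
qed

theorem lemma5p6:
  fixes G :: "('a, 'b) monoid_scheme" and p m :: nat
  assumes "Factorial_Ring.prime p" and "odd p"
    and "group G" and "Coset.order G = p ^ m"
    and "isoclinism_rank p G = 5"
    and "in_phi7 p G"
  shows
    "A_series G oo (fps_const (1 / real (Coset.order G)) * fps_X) =
         fps_const (1 - real p powi (-2)) / (1 - fps_const (real p powi (-2)) * fps_X)
       + fps_const (real p powi (-2) - real p powi (-4)) / (1 - fps_const (real p powi (-1)) * fps_X)
       + fps_const (real p powi (-4)) / (1 - fps_X)
     \<and>
     B_series G oo (fps_const (1 / real (Coset.order G)) * fps_X) =
         fps_const (- (real p powi (-1)) - real p powi (-2)) / (1 - fps_const (real p powi (-3)) * fps_X)
       + fps_const (1 + real p powi (-1) + real p powi (-2)) / (1 - fps_const (real p powi (-2)) * fps_X)"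
proof -
  have "finite (carrier G)" "isoclinic G (phi7_group p)"
    using assms(6) by (simp_all add: in_phi7_def finite_p_group_def)
  note counts = phi7_orbit_counts[OF assms(1-3) this]
  \<comment> \<open>The geometric series of ratio 1, whose denominator carries no explicit factor
    \<open>fps_const 1\<close>.\<close>
  have last: "fps_nth (fps_const k / (1 - fps_X)) n = k" for k :: real and n
    using fps_nth_geometric[of k 1 n] by simp
  show ?thesis
    by (intro conjI fps_ext)
      (simp_all only: fps_nth_compose_linear fps_add_nth fps_nth_geometric last A_series_def
        B_series_def fps_nth_Abs_fps counts[symmetric] power_one_over times_divide_eq_left mult_1_left)
qed

end
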